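(* Let $T=(T_1,\ldots,T_d)$ be a nilpotent commuting row contraction on some Hilbert space $\mathfrak{H}$. Let $\mathfrak{M}\subset\mathfrak{H}$ be a closed invariant subspace for $T$ such that $(T|_{\mathfrak{M}})^*$ has a cyclic vector and $\mathrm{Ann}_{\mathrm{c}}(T|_{\mathfrak{M}})=\mathrm{Ann}_{\mathrm{c}}(T)$. Then there is a subspace $\mathfrak{N}\subset\mathfrak{H}$ that is invariant for $T$ such that $\mathfrak{M}\cap\mathfrak{N}=\{0\}$ and $\mathfrak{H}=\overline{\mathfrak{M}+\mathfrak{N}}$.
   Context: Fix a positive integer $d$. The Drury--Arveson space $H^2_d$ is the Hilbert space of analytic functions $f=\sum_{\alpha\in\mathbb{N}^d}c_\alpha x^\alpha$ on the open unit ball $\mathbb{B}_d\subset\mathbb{C}^d$ with $\|f\|^2=\sum_{\alpha}\frac{\alpha!}{|\alpha|!}|c_\alpha|^2<\infty$; $x_1,\dots,x_d$ are the coordinate functions. $\mathcal{M}_d$ is its multiplier algebra, viewed as a weak-$*$ closed unital subalgebra of $B(H^2_d)$ via $\phi\mapsto M_\phi$, $M_\phi f=\phi f$. A $d$-tuple $T=(T_1,\dots,T_d)$ of bounded operators on $\mathfrak{H}$ is a row contraction if $\sum_{k=1}^d T_kT_k^*\le I$; it is commuting if the $T_k$ commute with each other; it is pure if $\lim_{n\to\infty}\sum_{|w|=n}\|T_w^*\xi\|^2=0$ for all $\xi\in\mathfrak{H}$, where $w=i_1\cdots i_n$ ranges over words of length $n$ in $\{1,\dots,d\}$ and $T_w=T_{i_1}\cdots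 T_{i_n}$. A commuting $d$-tuple is nilpotent if for each $k$ there is $m_k\in\mathbb{N}$ with $T_k^{m_k}=0$; a nilpotent commuting row contraction is pure. A vector $\xi$ is cyclic for a $d$-tuple $S$ on a Hilbert space if the space is the closed linear span of $\{S_w\xi\}$ over all words $w$ (including the empty word). For a pure commuting row contraction $T$ there is a unique unital completely contractive weak-$*$ continuous homomorphism $\mathcal{M}_d\to B(\mathfrak{H})$ sending $M_{x_k}$ to $T_k$ for each $k$; the image of $\phi$ is written $\phi(T)$. $\mathrm{Ann}_{\mathrm{c}}(T)=\{\phi\in\mathcal{M}_d:\phi(T)=0\}$. A subspace $\mathfrak{M}$ is invariant for $T$ if $T_k\mathfrak{M}\subset\mathfrak{M}$ for all $k$; $T|_{\mathfrak{M}}=(T_1|_{\mathfrak{M}},\ldots,T_d|_{\mathfrak{M}})$ and $(T|_{\mathfrak{M}})^*$ is the $d$-tuple of adjoints $((T_1|_{\mathfrak{M}})^*,\ldots,(T_d|_{\mathfrak{M}})^* )$ taken in $B(\mathfrak{M})$. *)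

theory Defs
  imports "HOL-Analysis.Analysis" "HOL-Library.Function_Algebras"
begin

section \<open>Complex Hilbert spaces\<close>

text \<open>The inner product is linear in its first argument. Positive definiteness is part of
  the axiom \<open>cinner_self\<close>, which also ties the inner product to the norm; completeness comes from
  \<^class>\<open>banach\<close>.\<close>

class complex_hilbert = banach +
  fixes scaleC :: "complex \<Rightarrow> 'a \<Rightarrow> 'a" (infixr "*\<^sub>C" 75)
    and cinner :: "'a \<Rightarrow> 'a \<Rightarrow> complex"
  assumes scaleC_add_right: "a *\<^sub>C (x + y) = a *\<^sub>C x + a *\<^sub>C y"
    and scaleC_add_left: "(a + b) *\<^sub>C x = a *\<^sub>C x + b *\<^sub>C x"
    and scaleC_scaleC: "a *\<^sub>C (b *\<^sub>C x) = (a * b) *\<^sub>C x"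
    and scaleR_scaleC: "r *\<^sub>R x = complex_of_real r *\<^sub>C x"
    and cinner_commute: "cinner x y = cnj (cinner y x)"
    and cinner_add_left: "cinner (x + y) z = cinner x z + cinner y z"
    and cinner_scaleC_left: "cinner (a *\<^sub>C x) y = a * cinner x y"
    and cinner_self: "cinner x x = complex_of_real ((norm x)\<^sup>2)"

definition csubspace :: "'a::complex_hilbert set \<Rightarrow> bool" where
  "csubspace V \<longleftrightarrow> 0 \<in> V \<and> (\<forall>x\<in>V. \<forall>y\<in>V. x + y \<in> V) \<and> (\<forall>a. \<forall>x\<in>V. a *\<^sub>C x \<in> V)"


section \<open>Operators on a closed subspace\<close>

text \<open>A Hilbert space is either a whole type or a closed subspace \<open>V\<close> of one, so every notion
  below takes the carrier \<open>V\<close> as a parameter (\<open>V = UNIV\<close> for the ambient space). An element of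
  \<open>B(V)\<close> is represented by its extension by \<open>0\<close> outside \<open>V\<close>, so that equality of operators on
  \<open>V\<close> is equality of functions.\<close>

definition bounded_ops :: "'a::complex_hilbert set \<Rightarrow> ('a \<Rightarrow> 'a) set" where
  "bounded_ops V = {A. (\<forall>x\<in>V. A x \<in> V) \<and> (\<forall>x. x \<notin> V \<longrightarrow> A x = 0) \<and>
     (\<forall>x\<in>V. \<forall>y\<in>V. A (x + y) = A x + A y) \<and> (\<forall>a. \<forall>x\<in>V. A (a *\<^sub>C x) = a *\<^sub>C A x) \<and>
     (\<exists>K. \<forall>x\<in>V. norm (A x) \<le> K * norm x)}"

definition op_restrict :: "'a::complex_hilbert set \<Rightarrow> ('a \<Rightarrow> 'a) \<Rightarrow> 'a \<Rightarrow> 'a" where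
  "op_restrict V A = (\<lambda>x. if x \<in> V then A x else 0)"

definition op_adjoint :: "'a::complex_hilbert set \<Rightarrow> ('a \<Rightarrow> 'a) \<Rightarrow> 'a \<Rightarrow> 'a" where
  "op_adjoint V A = (\<lambda>y. if y \<in> V
     then (THE z. z \<in> V \<and> (\<forall>x\<in>V. cinner (A x) y = cinner x z)) else 0)"

definition row_contraction :: "'a::complex_hilbert set \<Rightarrow> ('d::finite \<Rightarrow> 'a \<Rightarrow> 'a) \<Rightarrow> bool" where
  "row_contraction V T \<longleftrightarrow> (\<forall>k. T k \<in> bounded_ops V) \<and>
     (\<forall>x\<in>V. cinner (x - (\<Sum>k\<in>UNIV. T k (op_adjoint V (T k) x))) x \<in> \<real>\<^sub>\<ge>\<^sub>0)"

definition commuting :: "'a::complex_hilbert set \<Rightarrow> ('d \<Rightarrow> 'a \<Rightarrow> 'a) \<Rightarrow> bool" where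
  "commuting V T \<longleftrightarrow> (\<forall>j k. \<forall>x\<in>V. T j (T k x) = T k (T j x))"

definition nilpotent :: "'a::complex_hilbert set \<Rightarrow> ('d \<Rightarrow> 'a \<Rightarrow> 'a) \<Rightarrow> bool" where
  "nilpotent V T \<longleftrightarrow> (\<forall>k. \<exists>m. \<forall>x\<in>V. (T k ^^ m) x = 0)"

definition invariant_for :: "('d \<Rightarrow> 'a \<Rightarrow> 'a) \<Rightarrow> 'a::complex_hilbert set \<Rightarrow> bool" where
  "invariant_for T N \<longleftrightarrow> csubspace N \<and> (\<forall>k. T k ` N \<subseteq> N)"

text \<open>For a word \<open>w = [i\<^sub>1, \<dots>, i\<^sub>n]\<close>, \<open>foldr S w \<xi>\<close> is \<open>S\<^sub>w \<xi>\<close>, that is,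
  \<open>S\<close> at \<open>i\<^sub>1\<close> applied to \<open>\<dots>\<close> applied to \<open>S\<close> at \<open>i\<^sub>n\<close> applied to \<open>\<xi>\<close>.\<close>

definition cyclic_vector :: "'a::complex_hilbert set \<Rightarrow> ('d \<Rightarrow> 'a \<Rightarrow> 'a) \<Rightarrow> 'a \<Rightarrow> bool" where
  "cyclic_vector V S \<xi> \<longleftrightarrow> \<xi> \<in> V \<and> closure (csubspace hull {foldr S w \<xi> | w. True}) = V"


section \<open>The Drury--Arveson space and its multipliers\<close>

text \<open>Functions on the open unit ball of \<open>\<complex>\<^sup>d\<close> are total functions vanishing outside the ball.\<close>

definition on_ball :: "(complex^'d::finite \<Rightarrow> complex) \<Rightarrow> complex^'d \<Rightarrow> complex" where
  "on_ball g = (\<lambda>z. if z \<in> ball 0 1 then g z else 0)"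

definition da_weight :: "('d::finite \<Rightarrow> nat) \<Rightarrow> real" where
  "da_weight \<alpha> = (\<Prod>k\<in>UNIV. fact (\<alpha> k)) / fact (\<Sum>k\<in>UNIV. \<alpha> k)"

definition da_expansion :: "(complex^'d::finite \<Rightarrow> complex) \<Rightarrow> (('d \<Rightarrow> nat) \<Rightarrow> complex) \<Rightarrow> bool" where
  "da_expansion f c \<longleftrightarrow>
     (\<forall>z\<in>ball 0 1. ((\<lambda>\<alpha>. c \<alpha> * (\<Prod>k\<in>UNIV. (z $ k) ^ \<alpha> k)) has_sum f z) UNIV) \<and>
     (\<forall>z. z \<notin> ball 0 1 \<longrightarrow> f z = 0) \<and>
     (\<lambda>\<alpha>. da_weight \<alpha> * (cmod (c \<alpha>))\<^sup>2) summable_on UNIV"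

definition drury_arveson :: "(complex^'d::finite \<Rightarrow> complex) set" where
  "drury_arveson = {f. \<exists>c. da_expansion f c}"

definition da_coeff :: "(complex^'d::finite \<Rightarrow> complex) \<Rightarrow> ('d \<Rightarrow> nat) \<Rightarrow> complex" where
  "da_coeff f = (THE c. da_expansion f c)"

definition da_inner :: "(complex^'d::finite \<Rightarrow> complex) \<Rightarrow> (complex^'d \<Rightarrow> complex) \<Rightarrow> complex" where
  "da_inner f g = (\<Sum>\<^sub>\<infinity>\<alpha>. complex_of_real (da_weight \<alpha>) * da_coeff f \<alpha> * cnj (da_coeff g \<alpha>))"

definition ip_norm :: "('v \<Rightarrow> 'v \<Rightarrow> complex) \<Rightarrow> 'v \<Rightarrow> real" where
  "ip_norm ip v = sqrt (Re (ip v v))"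

text \<open>The product \<open>\<phi> * f\<close> is pointwise. Boundedness of \<open>f \<mapsto> \<phi> * f\<close> is automatic by the closed
  graph theorem; it is included to have \<open>M\<^sub>\<phi>\<close> in \<open>B(H\<^sup>2\<^sub>d)\<close> by definition.\<close>

definition da_multipliers :: "(complex^'d::finite \<Rightarrow> complex) set" where
  "da_multipliers = {\<phi>. (\<forall>z. z \<notin> ball 0 1 \<longrightarrow> \<phi> z = 0) \<and>
     (\<forall>f\<in>drury_arveson. \<phi> * f \<in> drury_arveson) \<and>
     (\<exists>K. \<forall>f\<in>drury_arveson. ip_norm da_inner (\<phi> * f) \<le> K * ip_norm da_inner f)}"


section \<open>The functional calculus and the annihilator\<close>

text \<open>The next two notions are used for two Hilbert spaces, \<open>H\<^sup>2\<^sub>d\<close> (a set of functions with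
  inner product \<^const>\<open>da_inner\<close>) and a closed subspace of a type in \<^class>\<open>complex_hilbert\<close>, and
  therefore take the carrier and the inner product as arguments.

  \<open>op_matrix_norm_le V ip n A C\<close> says that the operator matrix \<open>(A i j)\<close>, \<open>i, j < n\<close>, has norm at
  most \<open>C\<close> as an operator on the \<open>n\<close>-fold direct sum of \<open>V\<close>.\<close>

definition op_matrix_norm_le ::
  "'v::comm_monoid_add set \<Rightarrow> ('v \<Rightarrow> 'v \<Rightarrow> complex) \<Rightarrow> nat \<Rightarrow> (nat \<Rightarrow> nat \<Rightarrow> 'v \<Rightarrow> 'v) \<Rightarrow> real \<Rightarrow> bool" where
  "op_matrix_norm_le V ip n A C \<longleftrightarrow> (\<forall>v. (\<forall>j<n. v j \<in> V) \<longrightarrow>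
     L2_set (\<lambda>i. ip_norm ip (\<Sum>j<n. A i j (v j))) {..<n} \<le> C * L2_set (\<lambda>j. ip_norm ip (v j)) {..<n})"

text \<open>The weak-* topology of \<open>B(V)\<close>, pulled back along a family of operators \<open>A i\<close>, \<open>i \<in> I\<close>:
  the coarsest topology on \<open>I\<close> making \<open>i \<mapsto> tr (A i \<circ> R)\<close> continuous for every trace class \<open>R\<close>. Such
  functionals are exactly the ones of the form \<open>\<Sum>n. \<langle>A i (f n), g n\<rangle>\<close> with \<open>f\<close> and \<open>g\<close>
  square-summable.\<close>

definition weak_star ::
  "'v set \<Rightarrow> ('v \<Rightarrow> 'v \<Rightarrow> complex) \<Rightarrow> 'i set \<Rightarrow> ('i \<Rightarrow> 'v \<Rightarrow> 'v) \<Rightarrow> 'i topology" where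
  "weak_star V ip I A = topology_generated_by
     {{i \<in> I. (\<Sum>n. ip (A i (f n)) (g n)) \<in> U} | f g U.
        (\<forall>n::nat. f n \<in> V \<and> g n \<in> V) \<and> summable (\<lambda>n. (ip_norm ip (f n))\<^sup>2) \<and>
        summable (\<lambda>n. (ip_norm ip (g n))\<^sup>2) \<and> open U}"

definition functional_calculus ::
  "'a::complex_hilbert set \<Rightarrow> ('d::finite \<Rightarrow> 'a \<Rightarrow> 'a) \<Rightarrow> ((complex^'d \<Rightarrow> complex) \<Rightarrow> 'a \<Rightarrow> 'a) \<Rightarrow> bool" where
  "functional_calculus V T \<Phi> \<longleftrightarrow>
     (\<forall>\<phi>\<in>da_multipliers. \<Phi> \<phi> \<in> bounded_ops V) \<and>
     (\<forall>\<phi>\<in>da_multipliers. \<forall>\<psi>\<in>da_multipliers. \<Phi> (\<phi> + \<psi>) = \<Phi> \<phi> + \<Phi> \<psi>) \<and>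
     (\<forall>a. \<forall>\<phi>\<in>da_multipliers. \<Phi> (\<lambda>z. a * \<phi> z) = (\<lambda>x. a *\<^sub>C \<Phi> \<phi> x)) \<and>
     (\<forall>\<phi>\<in>da_multipliers. \<forall>\<psi>\<in>da_multipliers. \<Phi> (\<phi> * \<psi>) = \<Phi> \<phi> \<circ> \<Phi> \<psi>) \<and>
     \<Phi> (on_ball (\<lambda>z. 1)) = op_restrict V id \<and>
     (\<forall>k. \<Phi> (on_ball (\<lambda>z. z $ k)) = T k) \<and>
     (\<forall>n \<phi> C. (\<forall>i<n. \<forall>j<n. \<phi> i j \<in> da_multipliers) \<longrightarrow>
        op_matrix_norm_le drury_arveson da_inner n (\<lambda>i j f. \<phi> i j * f) C \<longrightarrow>
        op_matrix_norm_le V cinner n (\<lambda>i j. \<Phi> (\<phi> i j)) C) \<and>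
     continuous_map (weak_star drury_arveson da_inner da_multipliers (\<lambda>\<phi> f. \<phi> * f))
       (weak_star V cinner (bounded_ops V) (\<lambda>A. A)) \<Phi>"

text \<open>For a pure commuting row contraction \<open>T\<close> on \<open>V\<close>, a map \<open>\<Phi>\<close> as above exists and its values
  on \<^const>\<open>da_multipliers\<close> are uniquely determined. It is picked by \<open>SOME\<close> instead of \<open>THE\<close> only
  because, as a total function, it is arbitrary outside \<^const>\<open>da_multipliers\<close>.\<close>

definition calculus ::
  "'a::complex_hilbert set \<Rightarrow> ('d::finite \<Rightarrow> 'a \<Rightarrow> 'a) \<Rightarrow> (complex^'d \<Rightarrow> complex) \<Rightarrow> 'a \<Rightarrow> 'a" where
  "calculus V T = (SOME \<Phi>. functional_calculus V T \<Phi>)"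

definition Ann_c ::
  "'a::complex_hilbert set \<Rightarrow> ('d::finite \<Rightarrow> 'a \<Rightarrow> 'a) \<Rightarrow> (complex^'d \<Rightarrow> complex) set" where
  "Ann_c V T = {\<phi> \<in> da_multipliers. calculus V T \<phi> = 0}"

end

(* N is the largest invariant subspace annihilated by the functional <., xi>, where xi is the cyclic
   vector of the adjoint of T|M: it consists of the x with <p(T) x, xi> = 0 for all polynomials p.
   Cyclicity gives M \<inter> N = 0. Conversely, for x in H one looks for m in M with
   <T^a m, xi> = <T^a x, xi> for the finitely many a with T^a nonzero. This linear system is
   solvable because a relation between the functionals <T^a ., xi> on M is given by a
   polynomial annihilating T|M, hence T; so even M + N = H.

   The annihilators are defined through an arbitrary functional calculus, so one has to be
   constructed. For nilpotent T it is the polynomial calculus on truncated Taylor coefficients; its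
   complete contractivity follows by compressing multiplication operators along an isometry into
   H^2 \<otimes> C^r, obtained from a Gram factorization of I - sum T_k T_k^* on the finitely many
   vectors involved, so no operator square roots are needed. *)
theory Submission
  imports Defs
begin

section \<open>Hilbert space preliminaries\<close>

text \<open>Nilpotency makes N the common kernel of finitely many functionals <T^a ., xi>, so N has
  finite codimension and a density statement becomes a finite linear system. The relation behind its
  solvability: if sum c_a <T^a m, xi> = 0 for all m in M, then putting T^b m for m shows that sum
  c_a T^a m lies in N; it also lies in M, hence it is 0.

  Every functional calculus is forced on polynomials by linearity, multiplicativity and its values
  at 1 and the coordinates. The analytic clauses are the obstacle: without a witness satisfying
  them, \<open>SOME\<close> would return an unspecified function. The isometry that provides them is
  the Poisson kernel K u = sum_a (|a|!/a!) z^a D A^a u, with A_k the adjoint of T_k and D a square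
  root of the defect I - sum T_k A_k. The factors |a|!/a! are the reciprocal Drury--Arveson weights;
  their Pascal rule makes the weighted defect forms telescope degree by degree, and the remainder
  dies because high powers vanish. Gram vectors for the defect form replace D.\<close>

lemma cnj_cinner: "cnj (cinner x y) = cinner y x" for x :: "'a::complex_hilbert"
  by (rule cinner_commute[symmetric])

lemma cinner_add_right: "cinner x (y + z) = cinner x y + cinner x z"
  for x :: "'a::complex_hilbert"
  by (subst (1 2 3) cinner_commute) (simp add: cinner_add_left)

lemma cinner_scaleC_right: "cinner x (a *\<^sub>C y) = cnj a * cinner x y"
  for x :: "'a::complex_hilbert"
  by (subst (1 2) cinner_commute) (simp add: cinner_scaleC_left)

lemma cinner_zero_left [simp]: "cinner 0 y = 0" for y :: "'a::complex_hilbert"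
  using cinner_add_left[of 0 0 y] by simp

lemma cinner_zero_right [simp]: "cinner y 0 = 0" for y :: "'a::complex_hilbert"
  using cinner_add_right[of y 0 0] by simp

lemma scaleC_zero_left [simp]: "0 *\<^sub>C x = 0" for x :: "'a::complex_hilbert"
  using scaleC_add_left[of 0 0 x] by simp

lemma scaleC_zero_right [simp]: "a *\<^sub>C (0::'a::complex_hilbert) = 0"
  using scaleC_add_right[of a 0 0] by simp

lemma scaleC_one [simp]: "1 *\<^sub>C x = x" for x :: "'a::complex_hilbert"
  using scaleR_scaleC[of 1 x] by simp

lemma scaleC_minus_one: "(- 1) *\<^sub>C x = - x" for x :: "'a::complex_hilbert"
  using scaleR_scaleC[of "-1" x] by simp

lemma scaleC_sum_right: "a *\<^sub>C (\<Sum>i\<in>I. f i) = (\<Sum>i\<in>I. a *\<^sub>C (f i :: 'a::complex_hilbert))"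
  by (induction I rule: infinite_finite_induct) (auto simp: scaleC_add_right)

lemma cinner_minus_left: "cinner (- x) y = - cinner x y" for x :: "'a::complex_hilbert"
  using cinner_scaleC_left[of "-1" x y] by (simp add: scaleC_minus_one)

lemma cinner_minus_right: "cinner x (- y) = - cinner x y" for x :: "'a::complex_hilbert"
  using cinner_scaleC_right[of x "-1" y] by (simp add: scaleC_minus_one)

lemma cinner_diff_left: "cinner (x - y) z = cinner x z - cinner y z"
  for x :: "'a::complex_hilbert"
  using cinner_add_left[of x "- y" z] by (simp add: cinner_minus_left)

lemma cinner_diff_right: "cinner z (x - y) = cinner z x - cinner z y"
  for x :: "'a::complex_hilbert"
  using cinner_add_right[of z x "- y"] by (simp add: cinner_minus_right)

lemma cinner_sum_left: "cinner (\<Sum>i\<in>I. f i) y = (\<Sum>i\<in>I. cinner (f i) y)"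
  for y :: "'a::complex_hilbert"
  by (induction I rule: infinite_finite_induct) (auto simp: cinner_add_left)

lemma cinner_self_eq_0: "cinner x x = 0 \<longleftrightarrow> x = 0" for x :: "'a::complex_hilbert"
  by (simp add: cinner_self)

lemma Re_cinner_self: "Re (cinner x x) = (norm x)\<^sup>2" for x :: "'a::complex_hilbert"
  by (simp add: cinner_self)

lemma ip_norm_cinner [simp]: "ip_norm cinner x = norm x" for x :: "'a::complex_hilbert"
  by (simp add: ip_norm_def Re_cinner_self)

lemma norm_scaleC: "norm (a *\<^sub>C x) = cmod a * norm x" for x :: "'a::complex_hilbert"
proof -
  have "cinner (a *\<^sub>C x) (a *\<^sub>C x) = (a * cnj a) * cinner x x"
    by (simp add: cinner_scaleC_left cinner_scaleC_right)
  also have "\<dots> = complex_of_real ((cmod a * norm x)\<^sup>2)"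
    by (simp add: cinner_self complex_norm_square[symmetric] power_mult_distrib)
  finally have "(norm (a *\<^sub>C x))\<^sup>2 = (cmod a * norm x)\<^sup>2"
    using Re_cinner_self[of "a *\<^sub>C x"] by simp
  then show ?thesis by (simp add: power2_eq_iff_nonneg)
qed

lemma Re_cinner_commute: "Re (cinner x y) = Re (cinner y x)" for x :: "'a::complex_hilbert"
  by (subst cinner_commute) simp

lemma norm_add_sq: "(norm (x + y))\<^sup>2 = (norm x)\<^sup>2 + (norm y)\<^sup>2 + 2 * Re (cinner x y)"
  for x :: "'a::complex_hilbert"
  using Re_cinner_commute[of y x]
  by (simp add: Re_cinner_self[symmetric] cinner_add_left cinner_add_right)

lemma cinner_scaleR_right: "cinner x (t *\<^sub>R y) = complex_of_real t * cinner x y"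
  for x :: "'a::complex_hilbert"
  by (simp add: scaleR_scaleC cinner_scaleC_right)

lemma cauchy_schwarz: "cmod (cinner x y) \<le> norm x * norm y" for x :: "'a::complex_hilbert"
proof (cases "y = 0")
  case False
  define c where "c = cinner x y / cinner y y"
  have yy: "cinner y y \<noteq> 0" using False by (simp add: cinner_self)
  have "cinner (x - c *\<^sub>C y) (x - c *\<^sub>C y) = cinner x x - c * cinner y x
      - cnj c * (cinner x y - c * cinner y y)"
    by (simp add: cinner_diff_left cinner_diff_right cinner_scaleC_left cinner_scaleC_right
        algebra_simps)
  also have "\<dots> = cinner x x - cinner x y * cnj (cinner x y) / cinner y y"
    using yy cinner_commute[of y x] by (simp add: c_def)
  also have "\<dots> = complex_of_real ((norm x)\<^sup>2 - (cmod (cinner x y))\<^sup>2 / (norm y)\<^sup>2)"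
    by (simp add: cinner_self complex_norm_square[symmetric])
  finally have "(norm (x - c *\<^sub>C y))\<^sup>2 = (norm x)\<^sup>2 - (cmod (cinner x y))\<^sup>2 / (norm y)\<^sup>2"
    by (metis Re_cinner_self Re_complex_of_real)
  then have "(cmod (cinner x y))\<^sup>2 / (norm y)\<^sup>2 \<le> (norm x)\<^sup>2"
    by (smt (verit) zero_le_power2)
  then have "(cmod (cinner x y))\<^sup>2 \<le> (norm x * norm y)\<^sup>2"
    using False by (simp add: field_simps power_mult_distrib)
  then show ?thesis by (rule power2_le_imp_le) simp
qed simp

lemma csubspace_0: "csubspace V \<Longrightarrow> 0 \<in> V"
  and csubspace_add: "csubspace V \<Longrightarrow> x \<in> V \<Longrightarrow> y \<in> V \<Longrightarrow> x + y \<in> V"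
  and csubspace_scaleC: "csubspace V \<Longrightarrow> x \<in> V \<Longrightarrow> a *\<^sub>C x \<in> V"
  by (auto simp: csubspace_def)

lemma csubspace_scaleR: "csubspace V \<Longrightarrow> x \<in> V \<Longrightarrow> t *\<^sub>R x \<in> V"
  by (simp add: scaleR_scaleC csubspace_scaleC)

lemma csubspace_diff: "csubspace V \<Longrightarrow> x \<in> V \<Longrightarrow> y \<in> V \<Longrightarrow> x - y \<in> V"
  by (metis add_uminus_conv_diff csubspace_add csubspace_scaleC scaleC_minus_one)

lemma csubspace_sum: "csubspace V \<Longrightarrow> (\<And>i. i \<in> I \<Longrightarrow> f i \<in> V) \<Longrightarrow> (\<Sum>i\<in>I. f i) \<in> V"
  by (induction I rule: infinite_finite_induct) (auto simp: csubspace_0 csubspace_add)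

lemma csubspace_UNIV: "csubspace UNIV"
  by (simp add: csubspace_def)

text \<open>The quadratic vanishes at t = 0 and is nonnegative, so t = 0 is a minimum and the
  derivative 2 b there is zero. This is the first-order condition at the minimiser in
  \<open>riesz\<close>. The algebraic proof tests the vertex t = - b / a, where the value is - b^2 /
  a.\<close>

lemma linear_coeff_zero:
  fixes a b :: real
  assumes "\<And>t. 0 \<le> t\<^sup>2 * a + 2 * t * b"
  shows "b = 0"
proof (rule ccontr)
  assume b: "b \<noteq> 0"
  show False
  proof (cases "a = 0")
    case True
    then show False using assms[of "-b"] b by (simp add: not_le power2_eq_square[symmetric])
  next
    case False
    then have "(- b / a)\<^sup>2 * a + 2 * (- b / a) * b = - (b\<^sup>2 / a)"
      by (simp add: field_simps power2_eq_square)
    moreover have "a \<ge> 0"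
    proof (rule ccontr)
      assume "\<not> a \<ge> 0"
      then have "(2*b/a)\<^sup>2 * a + 2*(2*b/a)*b = 8 * (b\<^sup>2 / a)"
        by (simp add: field_simps power2_eq_square)
      moreover have "b\<^sup>2 / a < 0" using \<open>\<not> a \<ge> 0\<close> b by (simp add: divide_pos_neg)
      ultimately show False using assms[of "2*b/a"] by linarith
    qed
    ultimately show False using assms[of "- b / a"] b False
      by (smt (verit) divide_pos_pos zero_less_power2)
  qed
qed

text \<open>The representing vector minimises \<open>\<parallel>x\<parallel>\<^sup>2 - 2 Re (f x)\<close> over \<open>V\<close>; by the parallelogram law
  a minimising sequence is Cauchy.\<close>

lemma riesz:
  fixes V :: "'a::complex_hilbert set"
  assumes V: "csubspace V" "closed V"
    and add: "\<And>x y. x \<in> V \<Longrightarrow> y \<in> V \<Longrightarrow> f (x + y) = f x + f y"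
    and scale: "\<And>a x. x \<in> V \<Longrightarrow> f (a *\<^sub>C x) = a * f x"
    and bound: "\<And>x. x \<in> V \<Longrightarrow> cmod (f x) \<le> K * norm x"
  shows "\<exists>z\<in>V. \<forall>x\<in>V. f x = cinner x z"
proof -
  define Q where "Q x = (norm x)\<^sup>2 - 2 * Re (f x)" for x
  define I where "I = (INF x\<in>V. Q x)"
  have V0: "V \<noteq> {}" using csubspace_0[OF V(1)] by auto
  \<comment> \<open>With s the norm of x, complete the square: s^2 - 2 K s = (s - K)^2 -
    K^2.\<close>
  have low: "- (K\<^sup>2) \<le> Q x" if "x \<in> V" for x
  proof -
    have "Re (f x) \<le> K * norm x" using bound[OF that] complex_Re_le_cmod order_trans by blast
    moreover have "0 \<le> (norm x - K)\<^sup>2" by simp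
    ultimately show ?thesis unfolding Q_def power2_diff by (simp add: mult.commute)
  qed
  have bdd: "bdd_below (Q ` V)" using low by (intro bdd_belowI2) auto
  have IQ: "I \<le> Q x" if "x \<in> V" for x
    unfolding I_def using bdd that by (rule cINF_lower)
  have "\<exists>x\<in>V. Q x < I + 1 / real (Suc n)" for n
    unfolding I_def by (subst cINF_less_iff[OF V0 bdd, symmetric]) simp
  then obtain X where X: "\<And>n. X n \<in> V" "\<And>n. Q (X n) < I + 1 / real (Suc n)" by metis
  have fhalf: "f (t *\<^sub>R x) = of_real t * f x" if "x \<in> V" for t x
    using scale[OF that, of "of_real t"] by (simp add: scaleR_scaleC)
  have para: "(norm (x - y))\<^sup>2 \<le> 2 * (Q x - I) + 2 * (Q y - I)" if "x \<in> V" "y \<in> V" for x y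
  proof -
    have "(1/2) *\<^sub>R (x + y) \<in> V" 
      by (intro csubspace_add csubspace_scaleR V(1) that)
    then have "I \<le> Q ((1/2) *\<^sub>R (x + y))" by (rule IQ)
    also have "\<dots> = (norm (x + y))\<^sup>2 / 4 - (Re (f x) + Re (f y))"
      using that V(1) by (simp add: Q_def fhalf add csubspace_add power_mult_distrib
          power2_eq_square add_divide_distrib)
    finally have "I \<le> (norm (x + y))\<^sup>2 / 4 - (Re (f x) + Re (f y))" .
    moreover have "(norm (x - y))\<^sup>2 = 2 * (norm x)\<^sup>2 + 2 * (norm y)\<^sup>2 - (norm (x + y))\<^sup>2"
      using norm_add_sq[of x y] norm_add_sq[of x "- y"] by (simp add: cinner_minus_right)
    ultimately show ?thesis unfolding Q_def by (simp add: algebra_simps)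
  qed
  have "Cauchy X"
  proof (rule metric_CauchyI)
    fix e :: real assume e: "e > 0"
    obtain N where N: "4 / e\<^sup>2 < real N" using reals_Archimedean2 by blast
    have "dist (X m) (X n) < e" if "m \<ge> N" "n \<ge> N" for m n
    proof -
      have s: "Q (X k) - I < e\<^sup>2 / 4" if "k \<ge> N" for k
      proof -
        have "4 / e\<^sup>2 < real (Suc k)" using N that by linarith
        then have "1 / real (Suc k) < e\<^sup>2 / 4" using e by (simp add: field_simps)
        then show ?thesis using X(2)[of k] by linarith
      qed
      have "(norm (X m - X n))\<^sup>2 < e\<^sup>2"
        using para[OF X(1) X(1), of m n] add_strict_mono[OF s[OF that(1)] s[OF that(2)]]
        by (simp add: field_simps)
      then show ?thesis using e by (simp add: dist_norm power2_less_imp_less)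
    qed
    then show "\<exists>N. \<forall>m\<ge>N. \<forall>n\<ge>N. dist (X m) (X n) < e" by blast
  qed
  then obtain z where z: "X \<longlonglongrightarrow> z" using Cauchy_convergent convergent_def by blast
  have zV: "z \<in> V" using closed_sequentially[OF V(2) _ z] X(1) by blast
  have fdiff: "f (x - y) = f x - f y" if "x \<in> V" "y \<in> V" for x y
    using add[of "x - y" y] csubspace_diff[OF V(1) that] that by simp
  have "(\<lambda>n. f (X n)) \<longlonglongrightarrow> f z"
  proof (rule LIM_zero_cancel, rule tendsto_0_le[where K = "\<bar>K\<bar>"])
    show "(\<lambda>n. X n - z) \<longlonglongrightarrow> 0" using z by (simp add: LIM_zero)
    have "norm (f (X n) - f z) \<le> norm (X n - z) * \<bar>K\<bar>" for n
    proof -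
      have "norm (f (X n) - f z) \<le> K * norm (X n - z)"
        using bound[OF csubspace_diff[OF V(1) X(1)[of n] zV]] fdiff[OF X(1)[of n] zV] by simp
      also have "\<dots> \<le> \<bar>K\<bar> * norm (X n - z)" by (intro mult_right_mono) auto
      finally show ?thesis by (simp add: mult.commute)
    qed
    then show "\<forall>\<^sub>F n in sequentially. norm (f (X n) - f z) \<le> norm (X n - z) * \<bar>K\<bar>" by simp
  qed
  then have "(\<lambda>n. Q (X n)) \<longlonglongrightarrow> Q z"
    unfolding Q_def by (intro tendsto_intros z)
  moreover have "(\<lambda>n. I + 1 / real (Suc n)) \<longlonglongrightarrow> I + 0"
    by (intro tendsto_intros LIMSEQ_Suc[OF lim_1_over_n])
  ultimately have Qz: "Q z \<le> I"
    using less_imp_le[OF X(2)] by (intro LIMSEQ_le[where x = "Q z" and y = I]) auto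
  have re: "Re (f x) = Re (cinner x z)" if x: "x \<in> V" for x
  proof -
    have "0 \<le> t\<^sup>2 * (norm x)\<^sup>2 + 2 * t * (Re (cinner z x) - Re (f x))" for t
    proof -
      have "I \<le> Q (z + t *\<^sub>R x)" 
        by (intro IQ csubspace_add csubspace_scaleR V(1) x zV)
      then have "Q z \<le> Q (z + t *\<^sub>R x)" using Qz by linarith
      moreover have "f (z + t *\<^sub>R x) = f z + of_real t * f x"
        using add[OF zV csubspace_scaleR[OF V(1) x]] fhalf[OF x] by simp
      ultimately show ?thesis unfolding Q_def
        by (simp add: norm_add_sq cinner_scaleR_right power_mult_distrib algebra_simps)
    qed
    then have "Re (cinner z x) - Re (f x) = 0" by (rule linear_coeff_zero)
    then show ?thesis by (simp add: Re_cinner_commute[of x z])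
  qed
  have "f x = cinner x z" if x: "x \<in> V" for x
    \<comment> \<open>The real part at \<open>\<i> *\<^sub>C x\<close> encodes the imaginary part at
      \<open>x\<close>.\<close>
    using re[OF x] re[OF csubspace_scaleC[OF V(1) x], of "\<i>"] scale[OF x]
    by (simp add: cinner_scaleC_left complex_eq_iff)
  with zV show ?thesis by blast
qed

section \<open>Bounded operators on a closed subspace and their adjoints\<close>

lemma bounded_opsD:
  assumes "A \<in> bounded_ops V"
  shows "x \<in> V \<Longrightarrow> A x \<in> V" "x \<notin> V \<Longrightarrow> A x = 0"
    "x \<in> V \<Longrightarrow> y \<in> V \<Longrightarrow> A (x + y) = A x + A y" "x \<in> V \<Longrightarrow> A (a *\<^sub>C x) = a *\<^sub>C A x"
    "\<exists>K. \<forall>x\<in>V. norm (A x) \<le> K * norm x"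
  using assms unfolding bounded_ops_def by auto

lemma bounded_ops_0: "A \<in> bounded_ops V \<Longrightarrow> csubspace V \<Longrightarrow> A 0 = 0"
  using bounded_opsD(4)[of A V 0 0] csubspace_0[of V] by simp

text \<open>Two candidates differ by a vector of \<open>V\<close> orthogonal to all of
  \<open>V\<close>, in particular to itself. This resolves the \<open>THE\<close> in
  \<open>op_adjoint\<close>: exhibiting a representing vector suffices to compute an
  adjoint.\<close>

lemma op_adjoint_unique:
  fixes V :: "'a::complex_hilbert set"
  assumes V: "csubspace V" and "z \<in> V" "y \<in> V" "\<And>x. x \<in> V \<Longrightarrow> cinner (A x) y = cinner x z"
  shows "op_adjoint V A y = z"
proof -
  have "(THE z. z \<in> V \<and> (\<forall>x\<in>V. cinner (A x) y = cinner x z)) = z"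
  proof (rule the_equality)
    fix u assume u: "u \<in> V \<and> (\<forall>x\<in>V. cinner (A x) y = cinner x u)"
    then have "cinner (u - z) (u - z) = 0"
      using assms csubspace_diff[OF V, of u z] by (simp add: cinner_diff_right)
    then show "u = z" by (simp add: cinner_self)
  qed (use assms in auto)
  then show ?thesis using assms by (simp add: op_adjoint_def)
qed

lemma op_adjoint:
  fixes V :: "'a::complex_hilbert set"
  assumes V: "csubspace V" "closed V" and A: "A \<in> bounded_ops V" and y: "y \<in> V"
  shows op_adjoint_in: "op_adjoint V A y \<in> V"
    and cinner_op_adjoint: "x \<in> V \<Longrightarrow> cinner (A x) y = cinner x (op_adjoint V A y)"
proof -
  obtain K where K: "\<forall>x\<in>V. norm (A x) \<le> K * norm x" using bounded_opsD(5)[OF A] by auto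
  have "\<exists>z\<in>V. \<forall>x\<in>V. cinner (A x) y = cinner x z"
  proof (rule riesz[OF V, where K = "K * norm y"])
    fix x assume "x \<in> V"
    then have "norm (A x) * norm y \<le> (K * norm x) * norm y"
      using K by (intro mult_right_mono) auto
    then show "cmod (cinner (A x) y) \<le> K * norm y * norm x"
      using cauchy_schwarz[of "A x" y] by (simp add: mult_ac)
  qed (use bounded_opsD[OF A] in \<open>auto simp: cinner_add_left cinner_scaleC_left\<close>)
  then obtain z where z: "z \<in> V" "\<forall>x\<in>V. cinner (A x) y = cinner x z" by blast
  then have "op_adjoint V A y = z" using op_adjoint_unique V(1) y by metis
  then show "op_adjoint V A y \<in> V" "x \<in> V \<Longrightarrow> cinner (A x) y = cinner x (op_adjoint V A y)"
    using z by simp_all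
qed

lemma eq_if_cinner_eq:
  fixes V :: "'a::complex_hilbert set"
  assumes "csubspace V" "u \<in> V" "v \<in> V" "\<And>x. x \<in> V \<Longrightarrow> cinner x u = cinner x v"
  shows "u = v"
  using assms(4)[OF csubspace_diff[OF assms(1,2,3)]] cinner_self_eq_0[of "u - v"]
  by (simp add: cinner_diff_right)

lemma op_adjoint_linear:
  fixes V :: "'a::complex_hilbert set"
  assumes V: "csubspace V" "closed V" and A: "A \<in> bounded_ops V"
  shows "x \<in> V \<Longrightarrow> y \<in> V \<Longrightarrow> op_adjoint V A (x + y) = op_adjoint V A x + op_adjoint V A y"
    and "x \<in> V \<Longrightarrow> op_adjoint V A (a *\<^sub>C x) = a *\<^sub>C op_adjoint V A x"
proof -
  assume x: "x \<in> V"
  show "op_adjoint V A (x + y) = op_adjoint V A x + op_adjoint V A y" if y: "y \<in> V"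
    using op_adjoint_unique[OF V(1) csubspace_add[OF V(1) op_adjoint_in[OF V A x] op_adjoint_in[OF V A y]]
        csubspace_add[OF V(1) x y]]
    by (simp add: cinner_add_right cinner_op_adjoint[OF V A] x y)
  show "op_adjoint V A (a *\<^sub>C x) = a *\<^sub>C op_adjoint V A x"
    using op_adjoint_unique[OF V(1) csubspace_scaleC[OF V(1) op_adjoint_in[OF V A x]]
        csubspace_scaleC[OF V(1) x]]
    by (simp add: cinner_scaleC_right cinner_op_adjoint[OF V A] x)
qed

lemma op_adjoint_outside: "y \<notin> V \<Longrightarrow> op_adjoint V A y = 0"
  by (simp add: op_adjoint_def)

section \<open>Multi-indices and power series in several variables\<close>

definition unit_idx :: "'d \<Rightarrow> 'd \<Rightarrow> nat" where
  "unit_idx k = (\<lambda>j. if j = k then 1 else 0)"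

definition mdeg :: "('d::finite \<Rightarrow> nat) \<Rightarrow> nat" where
  "mdeg \<alpha> = (\<Sum>k\<in>UNIV. \<alpha> k)"

definition mpow :: "('d::finite \<Rightarrow> nat) \<Rightarrow> complex^'d \<Rightarrow> complex" where
  "mpow \<alpha> z = (\<Prod>k\<in>UNIV. (z $ k) ^ \<alpha> k)"

definition deg_below :: "nat \<Rightarrow> ('d::finite \<Rightarrow> nat) set" where
  "deg_below L = {\<alpha>. mdeg \<alpha> < L}"

lemma mdeg_add: "mdeg (\<alpha> + \<beta>) = mdeg \<alpha> + mdeg \<beta>"
  by (simp add: mdeg_def sum.distrib)

lemma mdeg_0 [simp]: "mdeg 0 = 0"
  by (simp add: mdeg_def)

lemma mdeg_unit_idx [simp]: "mdeg (unit_idx k) = 1"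
  by (simp add: mdeg_def unit_idx_def)

lemma mdeg_eq_0_iff: "mdeg \<alpha> = 0 \<longleftrightarrow> \<alpha> = 0"
  by (auto simp: mdeg_def fun_eq_iff)

lemma mdeg_ge: "\<alpha> k \<le> mdeg \<alpha>"
  unfolding mdeg_def by (rule member_le_sum) auto

lemma mpow_add: "mpow (\<alpha> + \<beta>) z = mpow \<alpha> z * mpow \<beta> z"
  by (simp add: mpow_def power_add prod.distrib)

lemma mpow_0 [simp]: "mpow 0 z = 1"
  by (simp add: mpow_def)

lemma mpow_unit_idx [simp]: "mpow (unit_idx k) z = z $ k"
proof -
  have "mpow (unit_idx k) z = (\<Prod>j\<in>UNIV. if j = k then z $ j else 1)"
    unfolding mpow_def unit_idx_def by (rule prod.cong) auto
  then show ?thesis by simp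
qed

lemma unit_idx_decomp: "\<alpha> k > 0 \<Longrightarrow> \<exists>\<beta>. \<alpha> = \<beta> + unit_idx k"
  by (rule exI[of _ "\<lambda>j. \<alpha> j - unit_idx k j"]) (auto simp: unit_idx_def fun_eq_iff)

text \<open>An index of positive degree has a positive entry, from which one unit can be removed.
  Facts about monomials and operator powers are proved one factor at a time this way.\<close>

lemma midx_induct [case_names zero add_unit]:
  fixes \<alpha> :: "'d::finite \<Rightarrow> nat"
  assumes "P 0" "\<And>\<alpha> k. P \<alpha> \<Longrightarrow> P (\<alpha> + unit_idx k)"
  shows "P \<alpha>"
proof (induction "mdeg \<alpha>" arbitrary: \<alpha>)
  case 0
  then have "\<alpha> = 0" using mdeg_eq_0_iff[of \<alpha>] by simp
  with assms(1) show ?case by blast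
next
  case (Suc n)
  then obtain k where "\<alpha> k > 0" by (force simp: mdeg_def)
  then obtain \<beta> where \<beta>: "\<alpha> = \<beta> + unit_idx k" using unit_idx_decomp[of \<alpha> k] by blast
  then have "n = mdeg \<beta>" using Suc(2) by (simp add: mdeg_add)
  from assms(2)[OF Suc(1)[OF this]] show ?case unfolding \<beta> .
qed

lemma finite_midx_le: "finite {\<alpha> :: 'd::finite \<Rightarrow> nat. \<forall>k. \<alpha> k \<le> b k}"
proof -
  have "{\<alpha> :: 'd \<Rightarrow> nat. \<forall>k. \<alpha> k \<le> b k} = (\<Pi>\<^sub>E k\<in>UNIV. {..b k})"
    by (auto simp: PiE_def extensional_def Pi_def)
  then show ?thesis by (simp add: finite_PiE)
qed

lemma finite_deg_below [simp]: "finite (deg_below L)"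
  by (rule finite_subset[OF _ finite_midx_le[of "\<lambda>_. L"]])
    (auto simp: deg_below_def intro: order.trans[OF mdeg_ge])

lemma finite_splits [simp]: "finite {p :: ('d::finite \<Rightarrow> nat) \<times> ('d \<Rightarrow> nat). fst p + snd p = \<gamma>}"
proof (rule finite_subset)
  show "{p. fst p + snd p = \<gamma>} \<subseteq> {\<alpha>. \<forall>k. \<alpha> k \<le> \<gamma> k} \<times> {\<alpha>. \<forall>k. \<alpha> k \<le> \<gamma> k}"
    by auto
qed (simp add: finite_midx_le)

text \<open>The truncated Cauchy product. Both parts of an index of degree below \<open>L\<close>
  have degree below \<open>L\<close>, so all pairs come from a finite square, and those with too
  large a sum are discarded.\<close>

lemma sum_splits_deg_below:
  "(\<Sum>\<gamma>\<in>deg_below L. \<Sum>p\<in>{p. fst p + snd p = \<gamma>}. G p) =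
   (\<Sum>\<alpha>\<in>deg_below L. \<Sum>\<beta>\<in>deg_below L. if \<alpha> + \<beta> \<in> deg_below L then G (\<alpha>, \<beta>) else 0)"
proof -
  have "(\<Sum>\<gamma>\<in>deg_below L. \<Sum>p\<in>{p. fst p + snd p = \<gamma>}. G p) =
      (\<Sum>(\<gamma>, p)\<in>Sigma (deg_below L) (\<lambda>\<gamma>. {p. fst p + snd p = \<gamma>}). G p)"
    by (rule sum.Sigma) auto
  also have "\<dots> = (\<Sum>p\<in>{p \<in> deg_below L \<times> deg_below L. fst p + snd p \<in> deg_below L}. G p)"
    by (rule sum.reindex_bij_witness[of _ "\<lambda>p. (fst p + snd p, p)" snd])
      (auto simp: deg_below_def mdeg_add)
  also have "\<dots> = (\<Sum>p\<in>deg_below L \<times> deg_below L.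
      if fst p + snd p \<in> deg_below L then G p else 0)"
    by (rule sum.inter_filter) simp
  also have "\<dots> = (\<Sum>(\<alpha>, \<beta>)\<in>deg_below L \<times> deg_below L.
      if \<alpha> + \<beta> \<in> deg_below L then G (\<alpha>, \<beta>) else 0)"
    by (rule sum.cong) auto
  finally show ?thesis by (simp only: sum.cartesian_product)
qed

section \<open>Uniqueness of power series coefficients on the ball, and products of series\<close>

lemma powser_eq_0:
  fixes a :: "nat \<Rightarrow> complex"
  assumes r: "0 < r" and s: "\<And>t. norm t < r \<Longrightarrow> (\<lambda>n. a n * t ^ n) sums 0"
  shows "a m = 0"
proof (induction m rule: less_induct)
  case (less m)
  have "(\<lambda>n. a (n + m) * t ^ n) sums 0" if t: "t \<noteq> 0" "norm t < r" for t
  proof -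
    have "(\<lambda>n. a (n + m) * t ^ (n + m)) sums (0 - (\<Sum>i<m. a i * t ^ i))"
      by (rule sums_split_initial_segment[OF s[OF t(2)]])
    then have "(\<lambda>n. a (n + m) * t ^ (n + m)) sums 0" using less by simp
    from sums_mult2[OF this, of "inverse (t ^ m)"] show ?thesis
      using t(1) by (simp add: power_add field_simps)
  qed
  from powser_limit_0_strong[OF r this] have "((\<lambda>_. 0) \<longlongrightarrow> a (0 + m)) (at (0::complex))" .
  then show ?case by (simp add: tendsto_const_iff)
qed

text \<open>The coefficients are isolated one variable at a time: \<open>K\<close> is the set of variables in which
  the exponent is already fixed.\<close>

lemma multi_powser_partial:
  fixes c :: "('d::finite \<Rightarrow> nat) \<Rightarrow> complex"
  assumes r: "0 < r"
    and s: "\<And>z. (\<forall>k. cmod (z k) < r) \<Longrightarrow>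
      ((\<lambda>\<alpha>. c \<alpha> * (\<Prod>k\<in>UNIV. z k ^ \<alpha> k)) has_sum 0) UNIV"
    and "finite K" and "\<forall>k. cmod (z k) < r"
  shows "((\<lambda>\<alpha>. c \<alpha> * (\<Prod>k\<in>-K. z k ^ \<alpha> k)) has_sum 0) {\<alpha>. \<forall>k\<in>K. \<alpha> k = \<gamma> k}"
  using assms(3,4)
proof (induction K arbitrary: z rule: finite_induct)
  case empty
  then show ?case using s by simp
next
  case (insert k K)
  define A where "A = {\<alpha>. \<forall>k\<in>K. \<alpha> k = \<gamma> k}"
  define B where "B n = {\<alpha>\<in>A. \<alpha> k = n}" for n
  define b where "b \<alpha> = c \<alpha> * (\<Prod>j\<in>-insert k K. z j ^ \<alpha> j)" for \<alpha>
  have hs: "((\<lambda>\<alpha>. b \<alpha> * t ^ \<alpha> k) has_sum 0) A" if t: "cmod t < r" for t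
  proof -
    have "((\<lambda>\<alpha>. c \<alpha> * (\<Prod>j\<in>-K. (z(k := t)) j ^ \<alpha> j)) has_sum 0) A"
      unfolding A_def by (rule insert.IH) (use insert.prems t in auto)
    moreover have "c \<alpha> * (\<Prod>j\<in>-K. (z(k := t)) j ^ \<alpha> j) = b \<alpha> * t ^ \<alpha> k" for \<alpha>
    proof -
      have "- K = insert k (- insert k K)" using insert.hyps by auto
      then have "(\<Prod>j\<in>-K. (z(k := t)) j ^ \<alpha> j) = t ^ \<alpha> k * (\<Prod>j\<in>-insert k K. (z(k := t)) j ^ \<alpha> j)"
        by simp
      also have "(\<Prod>j\<in>-insert k K. (z(k := t)) j ^ \<alpha> j) = (\<Prod>j\<in>-insert k K. z j ^ \<alpha> j)"
        by (rule prod.cong) auto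
      finally show ?thesis by (simp add: b_def)
    qed
    ultimately show ?thesis by simp
  qed
  have sm: "b summable_on B n" for n
  proof -
    \<comment> \<open>Any nonzero point of the disc would do: on \<open>B n\<close> the factor
      \<open>t ^ \<alpha> k\<close> is the constant \<open>t ^ n\<close>, which can then be divided
      out.\<close>
    define t where "t = complex_of_real (r / 2)"
    have t: "cmod t < r" "t \<noteq> 0" using r by (auto simp: t_def)
    have "(\<lambda>\<alpha>. b \<alpha> * t ^ \<alpha> k) summable_on B n"
      using has_sum_imp_summable[OF hs[OF t(1)]] by (rule summable_on_subset_banach) (auto simp: B_def)
    then have "(\<lambda>\<alpha>. b \<alpha> * t ^ n) summable_on B n"
      by (rule summable_on_cong[THEN iffD1, rotated]) (auto simp: B_def)
    then have "(\<lambda>\<alpha>. b \<alpha> * t ^ n * inverse (t ^ n)) summable_on B n"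
      by (rule summable_on_cmult_left)
    then show ?thesis using t by (simp add: mult.assoc)
  qed
  define s where "s n = infsum b (B n)" for n
  have "s m = 0" for m
  proof (rule powser_eq_0[OF r])
    fix t :: complex assume t: "norm t < r"
    have "((\<lambda>(n, \<alpha>). b \<alpha> * t ^ n) has_sum 0) (Sigma UNIV B)"
      by (subst has_sum_reindex_bij_witness[where j = snd and i = "\<lambda>\<alpha>. (\<alpha> k, \<alpha>)"
            and h = "\<lambda>\<alpha>. b \<alpha> * t ^ \<alpha> k" and T = A, OF _ _ _ _ _ refl])
        (auto simp: B_def hs[OF t])
    then have "((\<lambda>n. s n * t ^ n) has_sum 0) UNIV"
      by (rule has_sum_Sigma') (auto simp: s_def intro!: has_sum_cmult_left has_sum_infsum sm)
    then show "(\<lambda>n. s n * t ^ n) sums 0" by (rule has_sum_imp_sums)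
  qed
  then have "(b has_sum 0) (B (\<gamma> k))" using has_sum_infsum[OF sm, of "\<gamma> k"] by (simp add: s_def)
  moreover have "B (\<gamma> k) = {\<alpha>. \<forall>j\<in>insert k K. \<alpha> j = \<gamma> j}"
    by (auto simp: B_def A_def)
  ultimately show ?case by (simp add: b_def[abs_def])
qed

text \<open>The polydisc of radius 1/d lies in the unit ball, because the Euclidean norm is at most
  the sum of the moduli of the coordinates. Fixing the exponents of all variables leaves a single
  index and an empty product.\<close>

lemma has_sum_ball_zero:
  fixes c :: "('d::finite \<Rightarrow> nat) \<Rightarrow> complex"
  assumes "\<And>z. z \<in> ball 0 1 \<Longrightarrow> ((\<lambda>\<alpha>. c \<alpha> * mpow \<alpha> z) has_sum 0) UNIV"
  shows "c \<gamma> = 0"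
proof -
  have "((\<lambda>\<alpha>. c \<alpha> * (\<Prod>k\<in>-UNIV. 0 ^ \<alpha> k)) has_sum 0) {\<alpha>. \<forall>k\<in>UNIV. \<alpha> k = \<gamma> k}"
  proof (rule multi_powser_partial[where r = "1 / real CARD('d)"])
    fix z :: "'d \<Rightarrow> complex" assume z: "\<forall>k. cmod (z k) < 1 / real CARD('d)"
    have "norm (vec_lambda z) \<le> (\<Sum>k\<in>UNIV. cmod (z k))"
      unfolding norm_vec_def by (simp add: L2_set_le_sum)
    also have "\<dots> < (\<Sum>k\<in>(UNIV::'d set). 1 / real CARD('d))"
      by (rule sum_strict_mono) (use z in auto)
    finally have "vec_lambda z \<in> ball 0 1" by simp
    from assms[OF this] show "((\<lambda>\<alpha>. c \<alpha> * (\<Prod>k\<in>UNIV. z k ^ \<alpha> k)) has_sum 0) UNIV"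
      by (simp add: mpow_def)
  qed auto
  moreover have "{\<alpha>. \<forall>k\<in>UNIV. \<alpha> k = \<gamma> k} = {\<gamma>}" by auto
  ultimately have "((\<lambda>\<alpha>. c \<alpha>) has_sum 0) {\<gamma>}" by simp
  from has_sum_unique[OF this has_sum_finite] show ?thesis by simp
qed

lemma has_sum_ball_unique:
  fixes c :: "('d::finite \<Rightarrow> nat) \<Rightarrow> complex"
  assumes "\<And>z. z \<in> ball 0 1 \<Longrightarrow> ((\<lambda>\<alpha>. c \<alpha> * mpow \<alpha> z) has_sum f z) UNIV"
    and "\<And>z. z \<in> ball 0 1 \<Longrightarrow> ((\<lambda>\<alpha>. d \<alpha> * mpow \<alpha> z) has_sum f z) UNIV"
  shows "c = d"
proof
  fix \<gamma>
  have "c \<gamma> - d \<gamma> = 0"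
  proof (rule has_sum_ball_zero[of "\<lambda>\<alpha>. c \<alpha> - d \<alpha>"])
    fix z :: "complex^'d" assume "z \<in> ball 0 1"
    from has_sum_add[OF assms(1)[OF this] has_sum_uminusI[OF assms(2)[OF this]]]
    show "((\<lambda>\<alpha>. (c \<alpha> - d \<alpha>) * mpow \<alpha> z) has_sum 0) UNIV" by (simp add: left_diff_distrib)
  qed
  then show "c \<gamma> = d \<gamma>" by simp
qed

text \<open>Unordered complex sums converge absolutely, so the double family is summable and may be
  summed one variable at a time.\<close>

lemma has_sum_product:
  fixes f :: "'i \<Rightarrow> complex" and g :: "'j \<Rightarrow> complex"
  assumes f: "(f has_sum x) A" and g: "(g has_sum y) B"
  shows "((\<lambda>p. f (fst p) * g (snd p)) has_sum x * y) (A \<times> B)"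
proof -
  have fa: "(\<lambda>i. norm (f i)) summable_on A" and ga: "(\<lambda>j. norm (g j)) summable_on B"
    using has_sum_imp_summable[OF f] has_sum_imp_summable[OF g]
    by (simp_all add: summable_on_iff_abs_summable_on_complex)
  have "(\<lambda>p. norm (f (fst p) * g (snd p))) summable_on (Sigma A (\<lambda>_. B))"
    unfolding Infinite_Sum.abs_summable_on_Sigma_iff
    using fa ga by (auto simp: norm_mult infsum_cmult_right' abs_mult
        intro!: summable_on_cmult_right summable_on_cmult_left)
  then have "(\<lambda>p. f (fst p) * g (snd p)) summable_on (A \<times> B)"
    by (simp add: summable_on_iff_abs_summable_on_complex)
  then have hs: "((\<lambda>p. f (fst p) * g (snd p)) has_sum infsum (\<lambda>p. f (fst p) * g (snd p)) (A \<times> B)) (A \<times> B)"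
    by (rule has_sum_infsum)
  have "((\<lambda>i. f i * y) has_sum infsum (\<lambda>p. f (fst p) * g (snd p)) (A \<times> B)) A"
    by (rule has_sum_Sigma'[OF hs]) (auto intro: has_sum_cmult_right g)
  moreover have "((\<lambda>i. f i * y) has_sum x * y) A" using f by (rule has_sum_cmult_left)
  ultimately have "infsum (\<lambda>p. f (fst p) * g (snd p)) (A \<times> B) = x * y" by (rule has_sum_unique)
  with hs show ?thesis by simp
qed

section \<open>The Drury--Arveson space and its multipliers\<close>

lemma da_weight_pos: "0 < da_weight \<alpha>"
  unfolding da_weight_def by (intro divide_pos_pos prod_pos) auto

lemma da_weight_nonneg [simp]: "0 \<le> da_weight \<alpha>"
  using da_weight_pos[of \<alpha>] by simp

lemma da_weight_add_unit:
  "da_weight (\<alpha> + unit_idx k) = da_weight \<alpha> * (real (\<alpha> k + 1) / real (mdeg \<alpha> + 1))"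
proof -
  have "(\<Prod>j\<in>UNIV. fact ((\<alpha> + unit_idx k) j) :: real) =
      (\<Prod>j\<in>UNIV. fact (\<alpha> j) * (if j = k then real (\<alpha> k + 1) else 1))"
    by (rule prod.cong) (auto simp: unit_idx_def)
  also have "\<dots> = (\<Prod>j\<in>UNIV. fact (\<alpha> j)) * real (\<alpha> k + 1)"
    by (simp add: prod.distrib)
  finally have "(\<Prod>j\<in>UNIV. fact ((\<alpha> + unit_idx k) j) :: real) =
      (\<Prod>j\<in>UNIV. fact (\<alpha> j)) * real (\<alpha> k + 1)" .
  moreover have "(\<Sum>j\<in>UNIV. (\<alpha> + unit_idx k) j) = mdeg \<alpha> + 1"
    using mdeg_unit_idx[of k] by (simp add: sum.distrib mdeg_def)
  ultimately show ?thesis by (simp add: da_weight_def mdeg_def[symmetric] field_simps)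
qed

lemma da_weight_add_unit_le: "da_weight (\<alpha> + unit_idx k) \<le> da_weight \<alpha>"
proof -
  have "real (\<alpha> k + 1) / real (mdeg \<alpha> + 1) \<le> 1" using mdeg_ge[of \<alpha> k] by simp
  then show ?thesis unfolding da_weight_add_unit by (intro mult_left_le) auto
qed

lemma da_expansion_iff:
  "da_expansion f c \<longleftrightarrow>
     (\<forall>z\<in>ball 0 1. ((\<lambda>\<alpha>. c \<alpha> * mpow \<alpha> z) has_sum f z) UNIV) \<and>
     (\<forall>z. z \<notin> ball 0 1 \<longrightarrow> f z = 0) \<and>
     (\<lambda>\<alpha>. da_weight \<alpha> * (cmod (c \<alpha>))\<^sup>2) summable_on UNIV"
  by (simp add: da_expansion_def mpow_def)

lemma da_expansion_unique: "da_expansion f c \<Longrightarrow> da_expansion f d \<Longrightarrow> c = d"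
  using has_sum_ball_unique[of c f d] by (simp add: da_expansion_iff)

lemma da_coeff_eq: "da_expansion f c \<Longrightarrow> da_coeff f = c"
  unfolding da_coeff_def using da_expansion_unique by blast

lemma da_expansion_coeff: "f \<in> drury_arveson \<Longrightarrow> da_expansion f (da_coeff f)"
  using da_coeff_eq by (auto simp: drury_arveson_def)

lemma drury_arvesonI: "da_expansion f c \<Longrightarrow> f \<in> drury_arveson"
  by (auto simp: drury_arveson_def)

lemma da_summable:
  "f \<in> drury_arveson \<Longrightarrow> (\<lambda>\<alpha>. da_weight \<alpha> * (cmod (da_coeff f \<alpha>))\<^sup>2) summable_on UNIV"
  using da_expansion_coeff by (auto simp: da_expansion_iff)

text \<open>A crude form of the triangle inequality that survives multiplication by weights and
  summation. It is used only where some finite bound is wanted: for sums of square-summable series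
  and of multipliers.\<close>

lemma norm_add_sq_le: "(norm (x + y))\<^sup>2 \<le> 2 * (norm x)\<^sup>2 + 2 * (norm y)\<^sup>2"
  for x :: "'v::real_normed_vector"
proof -
  have "(norm (x + y))\<^sup>2 \<le> (norm x + norm y)\<^sup>2"
    by (intro power_mono norm_triangle_ineq) auto
  also have "\<dots> \<le> 2 * (norm x)\<^sup>2 + 2 * (norm y)\<^sup>2"
    using sum_squares_bound[of "norm x" "norm y"] by (simp add: power2_sum)
  finally show ?thesis .
qed

lemma da_expansion_add:
  assumes f: "da_expansion f c" and g: "da_expansion g d"
  shows "da_expansion (f + g) (\<lambda>\<alpha>. c \<alpha> + d \<alpha>)"
proof -
  have "(\<lambda>\<alpha>. 2 * (da_weight \<alpha> * (cmod (c \<alpha>))\<^sup>2) + 2 * (da_weight \<alpha> * (cmod (d \<alpha>))\<^sup>2)) summable_on UNIV"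
    using f g by (intro summable_on_add summable_on_cmult_right) (auto simp: da_expansion_iff)
  then have "(\<lambda>\<alpha>. da_weight \<alpha> * (cmod (c \<alpha> + d \<alpha>))\<^sup>2) summable_on UNIV"
  proof (rule summable_on_comparison_test)
    fix \<alpha> :: "'a \<Rightarrow> nat"
    show "da_weight \<alpha> * (cmod (c \<alpha> + d \<alpha>))\<^sup>2 \<le>
        2 * (da_weight \<alpha> * (cmod (c \<alpha>))\<^sup>2) + 2 * (da_weight \<alpha> * (cmod (d \<alpha>))\<^sup>2)"
      using mult_left_mono[OF norm_add_sq_le[of "c \<alpha>" "d \<alpha>"] da_weight_nonneg[of \<alpha>]]
      by (simp add: algebra_simps)
  qed auto
  then show ?thesis
    using f g by (auto simp: da_expansion_iff distrib_right intro!: has_sum_add)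
qed

lemma da_expansion_cmult:
  assumes f: "da_expansion f c"
  shows "da_expansion (\<lambda>z. a * f z) (\<lambda>\<alpha>. a * c \<alpha>)"
proof -
  have "(\<lambda>\<alpha>. (cmod a)\<^sup>2 * (da_weight \<alpha> * (cmod (c \<alpha>))\<^sup>2)) summable_on UNIV"
    using f by (intro summable_on_cmult_right) (auto simp: da_expansion_iff)
  then show ?thesis
    using f by (auto simp: da_expansion_iff norm_mult power_mult_distrib mult_ac
        dest!: has_sum_cmult_right[where c = a])
qed

lemma da_expansion_zero: "da_expansion 0 (\<lambda>_. 0)"
  by (simp add: da_expansion_iff)

lemma da_expansion_sum:
  assumes "\<And>i. i \<in> I \<Longrightarrow> da_expansion (f i) (c i)"
  shows "da_expansion (\<Sum>i\<in>I. f i) (\<lambda>\<alpha>. \<Sum>i\<in>I. c i \<alpha>)"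
  using assms
proof (induction I rule: infinite_finite_induct)
  case (insert i I)
  have "da_expansion (f i + (\<Sum>i\<in>I. f i)) (\<lambda>\<alpha>. c i \<alpha> + (\<Sum>i\<in>I. c i \<alpha>))"
    by (intro da_expansion_add insert.IH insert.prems) auto
  then show ?case unfolding sum.insert[OF insert.hyps] .
qed (auto simp: da_expansion_zero)

definition da_poly :: "('d::finite \<Rightarrow> nat) set \<Rightarrow> (('d \<Rightarrow> nat) \<Rightarrow> complex) \<Rightarrow> complex^'d \<Rightarrow> complex" where
  "da_poly F c = on_ball (\<lambda>z. \<Sum>\<alpha>\<in>F. c \<alpha> * mpow \<alpha> z)"

lemma da_expansion_poly:
  assumes "finite F"
  shows "da_expansion (da_poly F c) (\<lambda>\<alpha>. if \<alpha> \<in> F then c \<alpha> else 0)"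
proof -
  have "((\<lambda>\<alpha>. (if \<alpha> \<in> F then c \<alpha> else 0) * mpow \<alpha> z) has_sum (\<Sum>\<alpha>\<in>F. c \<alpha> * mpow \<alpha> z)) UNIV" for z
    by (rule has_sum_finite_neutralI[OF assms]) (auto intro: sum.cong)
  moreover have "(\<lambda>\<alpha>. da_weight \<alpha> * (cmod (if \<alpha> \<in> F then c \<alpha> else 0))\<^sup>2) summable_on UNIV"
    by (rule has_sum_imp_summable, rule has_sum_finite_neutralI[OF assms _ _ refl]) auto
  ultimately show ?thesis by (simp add: da_expansion_iff da_poly_def on_ball_def)
qed

section \<open>Norms and inner products in terms of coefficients\<close>

lemma da_inner_self:
  assumes "f \<in> drury_arveson"
  shows "da_inner f f = complex_of_real (\<Sum>\<^sub>\<infinity>\<alpha>. da_weight \<alpha> * (cmod (da_coeff f \<alpha>))\<^sup>2)"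
proof -
  have "da_inner f f = (\<Sum>\<^sub>\<infinity>\<alpha>. complex_of_real (da_weight \<alpha> * (cmod (da_coeff f \<alpha>))\<^sup>2))"
    unfolding da_inner_def
    by (rule infsum_cong) (simp add: mult.assoc complex_norm_square[symmetric])
  also have "\<dots> = complex_of_real (\<Sum>\<^sub>\<infinity>\<alpha>. da_weight \<alpha> * (cmod (da_coeff f \<alpha>))\<^sup>2)"
    using has_sum_of_real[OF has_sum_infsum[OF da_summable[OF assms]]] by (rule infsumI)
  finally show ?thesis .
qed

lemma da_norm_sq:
  assumes "f \<in> drury_arveson"
  shows "(ip_norm da_inner f)\<^sup>2 = (\<Sum>\<^sub>\<infinity>\<alpha>. da_weight \<alpha> * (cmod (da_coeff f \<alpha>))\<^sup>2)"
  by (simp add: ip_norm_def da_inner_self[OF assms] infsum_nonneg)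

lemma ip_norm_da_nonneg [simp]: "f \<in> drury_arveson \<Longrightarrow> 0 \<le> ip_norm da_inner f"
  by (simp add: ip_norm_def da_inner_self infsum_nonneg)

lemma finite_sum_le_da_norm_sq:
  assumes "f \<in> drury_arveson" "finite F"
  shows "(\<Sum>\<alpha>\<in>F. da_weight \<alpha> * (cmod (da_coeff f \<alpha>))\<^sup>2) \<le> (ip_norm da_inner f)\<^sup>2"
  unfolding da_norm_sq[OF assms(1)]
  by (rule finite_sum_le_infsum[OF da_summable[OF assms(1)] assms(2)]) auto

lemma da_norm_sq_poly:
  assumes "finite F"
  shows "(ip_norm da_inner (da_poly F c))\<^sup>2 = (\<Sum>\<alpha>\<in>F. da_weight \<alpha> * (cmod (c \<alpha>))\<^sup>2)"
  unfolding da_norm_sq[OF drury_arvesonI[OF da_expansion_poly[OF assms]]]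
    da_coeff_eq[OF da_expansion_poly[OF assms]]
  by (rule infsumI, rule has_sum_finite_neutralI[OF assms]) auto

text \<open>The finite support of the second argument turns the series into a finite sum without any
  convergence question. The compression and continuity arguments therefore always have a polynomial
  in the second slot.\<close>

lemma da_inner_poly:
  assumes "finite F"
  shows "da_inner f (da_poly F c) = (\<Sum>\<alpha>\<in>F. of_real (da_weight \<alpha>) * da_coeff f \<alpha> * cnj (c \<alpha>))"
  unfolding da_inner_def da_coeff_eq[OF da_expansion_poly[OF assms]]
  by (rule infsumI, rule has_sum_finite_neutralI[OF assms]) auto

lemma da_norm_add_sq_le:
  assumes f: "f \<in> drury_arveson" and g: "g \<in> drury_arveson"
  shows "(ip_norm da_inner (f + g))\<^sup>2 \<le> 2 * (ip_norm da_inner f)\<^sup>2 + 2 * (ip_norm da_inner g)\<^sup>2"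
proof -
  note fg = da_expansion_add[OF da_expansion_coeff[OF f] da_expansion_coeff[OF g]]
  have "(ip_norm da_inner (f + g))\<^sup>2 \<le>
      (\<Sum>\<^sub>\<infinity>\<alpha>. 2 * (da_weight \<alpha> * (cmod (da_coeff f \<alpha>))\<^sup>2) + 2 * (da_weight \<alpha> * (cmod (da_coeff g \<alpha>))\<^sup>2))"
    unfolding da_norm_sq[OF drury_arvesonI[OF fg]]
  proof (rule infsum_mono)
    fix \<alpha> :: "'a \<Rightarrow> nat"
    show "da_weight \<alpha> * (cmod (da_coeff (f + g) \<alpha>))\<^sup>2 \<le>
        2 * (da_weight \<alpha> * (cmod (da_coeff f \<alpha>))\<^sup>2) + 2 * (da_weight \<alpha> * (cmod (da_coeff g \<alpha>))\<^sup>2)"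
      using mult_left_mono[OF norm_add_sq_le[of "da_coeff f \<alpha>" "da_coeff g \<alpha>"] da_weight_nonneg[of \<alpha>]]
      by (simp add: algebra_simps da_coeff_eq[OF fg])
  qed (use f g fg in \<open>auto intro!: summable_on_add summable_on_cmult_right da_summable drury_arvesonI\<close>)
  also have "\<dots> = 2 * (ip_norm da_inner f)\<^sup>2 + 2 * (ip_norm da_inner g)\<^sup>2"
    unfolding da_norm_sq[OF f] da_norm_sq[OF g]
    by (subst infsum_add) (auto intro!: summable_on_cmult_right da_summable f g simp: infsum_cmult_right')
  finally show ?thesis .
qed

lemma da_norm_cmult:
  assumes f: "f \<in> drury_arveson"
  shows "ip_norm da_inner (\<lambda>z. a * f z) = cmod a * ip_norm da_inner f"
proof -
  note af = da_expansion_cmult[OF da_expansion_coeff[OF f], of a]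
  have "(ip_norm da_inner (\<lambda>z. a * f z))\<^sup>2 = (cmod a)\<^sup>2 * (ip_norm da_inner f)\<^sup>2"
    unfolding da_norm_sq[OF f] da_norm_sq[OF drury_arvesonI[OF af]] da_coeff_eq[OF af]
    by (subst infsum_cmult_right'[symmetric]) (simp add: norm_mult power_mult_distrib mult_ac)
  then show ?thesis
    using f drury_arvesonI[OF af] by (simp add: power2_eq_iff_nonneg flip: power_mult_distrib)
qed

lemma da_one: "on_ball (\<lambda>z. 1) \<in> drury_arveson"
  using drury_arvesonI[OF da_expansion_poly[of "{0}" "\<lambda>_. 1"]] by (simp add: da_poly_def)

lemma mult_on_ball_one: "\<forall>z. z \<notin> ball 0 1 \<longrightarrow> f z = 0 \<Longrightarrow> f * on_ball (\<lambda>z. 1) = f"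
  by (auto simp: on_ball_def fun_eq_iff)

section \<open>The multiplier algebra\<close>

lemma da_multipliersD:
  assumes "\<phi> \<in> da_multipliers"
  shows "z \<notin> ball 0 1 \<Longrightarrow> \<phi> z = 0" "f \<in> drury_arveson \<Longrightarrow> \<phi> * f \<in> drury_arveson"
    "\<exists>K\<ge>0. \<forall>f\<in>drury_arveson. ip_norm da_inner (\<phi> * f) \<le> K * ip_norm da_inner f"
proof -
  obtain K where K: "\<forall>f\<in>drury_arveson. ip_norm da_inner (\<phi> * f) \<le> K * ip_norm da_inner f"
    using assms by (auto simp: da_multipliers_def)
  have "ip_norm da_inner (\<phi> * f) \<le> \<bar>K\<bar> * ip_norm da_inner f" if "f \<in> drury_arveson" for f
    using bspec[OF K that] mult_right_mono[OF abs_ge_self ip_norm_da_nonneg[OF that], of K] by simp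
  then show "\<exists>K\<ge>0. \<forall>f\<in>drury_arveson. ip_norm da_inner (\<phi> * f) \<le> K * ip_norm da_inner f"
    by (intro exI[of _ "\<bar>K\<bar>"]) auto
qed (use assms in \<open>auto simp: da_multipliers_def\<close>)

text \<open>Apply the multiplier to the constant function 1, which lies in the space. Hence a
  multiplier has Taylor coefficients, on which the calculus is built.\<close>

lemma multiplier_in_da: "\<phi> \<in> da_multipliers \<Longrightarrow> \<phi> \<in> drury_arveson"
  using da_multipliersD(2)[OF _ da_one, of \<phi>] da_multipliersD(1)[of \<phi>] mult_on_ball_one[of \<phi>]
  by simp

lemma da_multipliers_add:
  assumes \<phi>: "\<phi> \<in> da_multipliers" and \<psi>: "\<psi> \<in> da_multipliers"
  shows "\<phi> + \<psi> \<in> da_multipliers"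
proof -
  have fm: "(\<phi> + \<psi>) * f = \<phi> * f + \<psi> * f" for f by (simp add: fun_eq_iff distrib_right)
  have in_da: "(\<phi> + \<psi>) * f \<in> drury_arveson" if "f \<in> drury_arveson" for f
    unfolding fm using da_expansion_add[OF da_expansion_coeff da_expansion_coeff]
      da_multipliersD(2)[OF \<phi> that] da_multipliersD(2)[OF \<psi> that] drury_arvesonI by blast
  obtain K where K: "K \<ge> 0" "\<forall>f\<in>drury_arveson. ip_norm da_inner (\<phi> * f) \<le> K * ip_norm da_inner f"
    using da_multipliersD(3)[OF \<phi>] by auto
  obtain L where L: "L \<ge> 0" "\<forall>f\<in>drury_arveson. ip_norm da_inner (\<psi> * f) \<le> L * ip_norm da_inner f"
    using da_multipliersD(3)[OF \<psi>] by auto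
  \<comment> \<open>The constant comes from \<open>da_norm_add_sq_le\<close>, which works with
    squares and costs a factor 2 for each summand.\<close>
  have "ip_norm da_inner ((\<phi> + \<psi>) * f) \<le> sqrt (2 * K\<^sup>2 + 2 * L\<^sup>2) * ip_norm da_inner f"
    if f: "f \<in> drury_arveson" for f
  proof (rule power2_le_imp_le)
    have "(ip_norm da_inner ((\<phi> + \<psi>) * f))\<^sup>2 \<le>
        2 * (ip_norm da_inner (\<phi> * f))\<^sup>2 + 2 * (ip_norm da_inner (\<psi> * f))\<^sup>2"
      unfolding fm by (intro da_norm_add_sq_le da_multipliersD(2) \<phi> \<psi> f)
    also have "\<dots> \<le> 2 * (K * ip_norm da_inner f)\<^sup>2 + 2 * (L * ip_norm da_inner f)\<^sup>2"
      using K L f \<phi> \<psi> by (intro add_mono mult_left_mono power_mono ip_norm_da_nonneg da_multipliersD(2)) auto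
    also have "\<dots> = (sqrt (2 * K\<^sup>2 + 2 * L\<^sup>2) * ip_norm da_inner f)\<^sup>2"
      by (simp add: power_mult_distrib algebra_simps)
    finally show "(ip_norm da_inner ((\<phi> + \<psi>) * f))\<^sup>2 \<le> (sqrt (2 * K\<^sup>2 + 2 * L\<^sup>2) * ip_norm da_inner f)\<^sup>2" .
  qed (use f in simp)
  then show ?thesis unfolding da_multipliers_def
    using in_da da_multipliersD(1)[OF \<phi>] da_multipliersD(1)[OF \<psi>] by auto
qed

lemma da_multipliers_cmult:
  assumes \<phi>: "\<phi> \<in> da_multipliers"
  shows "(\<lambda>z. a * \<phi> z) \<in> da_multipliers"
proof -
  have fm: "(\<lambda>z. a * \<phi> z) * f = (\<lambda>z. a * (\<phi> * f) z)" for f by (simp add: fun_eq_iff mult_ac)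
  obtain K where K: "K \<ge> 0" "\<forall>f\<in>drury_arveson. ip_norm da_inner (\<phi> * f) \<le> K * ip_norm da_inner f"
    using da_multipliersD(3)[OF \<phi>] by auto
  have "ip_norm da_inner ((\<lambda>z. a * \<phi> z) * f) \<le> (cmod a * K) * ip_norm da_inner f"
    if f: "f \<in> drury_arveson" for f
    unfolding fm da_norm_cmult[OF da_multipliersD(2)[OF \<phi> f]] mult.assoc
    by (rule mult_left_mono[OF bspec[OF K(2) f]]) simp
  moreover have "(\<lambda>z. a * \<phi> z) * f \<in> drury_arveson" if f: "f \<in> drury_arveson" for f
    unfolding fm by (rule drury_arvesonI[OF da_expansion_cmult[OF da_expansion_coeff]])
      (rule da_multipliersD(2)[OF \<phi> f])
  ultimately show ?thesis unfolding da_multipliers_def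
    using da_multipliersD(1)[OF \<phi>] by auto
qed

lemma da_multipliers_mult:
  assumes \<phi>: "\<phi> \<in> da_multipliers" and \<psi>: "\<psi> \<in> da_multipliers"
  shows "\<phi> * \<psi> \<in> da_multipliers"
proof -
  have fm: "(\<phi> * \<psi>) * f = \<phi> * (\<psi> * f)" for f by (simp add: fun_eq_iff mult_ac)
  obtain K where K: "K \<ge> 0" "\<forall>f\<in>drury_arveson. ip_norm da_inner (\<phi> * f) \<le> K * ip_norm da_inner f"
    using da_multipliersD(3)[OF \<phi>] by auto
  obtain L where L: "L \<ge> 0" "\<forall>f\<in>drury_arveson. ip_norm da_inner (\<psi> * f) \<le> L * ip_norm da_inner f"
    using da_multipliersD(3)[OF \<psi>] by auto
  have "ip_norm da_inner ((\<phi> * \<psi>) * f) \<le> (K * L) * ip_norm da_inner f" if f: "f \<in> drury_arveson" for f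
    using bspec[OF K(2) da_multipliersD(2)[OF \<psi> f]] mult_left_mono[OF bspec[OF L(2) f] K(1)]
    by (simp add: fm mult.assoc)
  then show ?thesis unfolding da_multipliers_def
    using da_multipliersD[OF \<phi>] da_multipliersD[OF \<psi>] by (auto simp: fm)
qed

lemma da_multipliers_one: "on_ball (\<lambda>z :: complex^'d::finite. 1) \<in> da_multipliers"
proof -
  have "on_ball (\<lambda>z. 1) * f = f" if "f \<in> drury_arveson" for f :: "complex^'d \<Rightarrow> complex"
    using da_expansion_coeff[OF that] mult_on_ball_one[of f] by (simp add: da_expansion_iff mult.commute)
  moreover have "on_ball (\<lambda>z. 1) z = 0" if "z \<notin> ball 0 1" for z :: "complex^'d"
    using that by (simp add: on_ball_def)
  ultimately show ?thesis unfolding da_multipliers_def by (auto intro!: exI[of _ 1])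
qed

text \<open>Multiplication by a coordinate shifts the coefficients by one unit, and the weight does
  not increase under this shift. So the square norm does not increase either.\<close>

lemma da_expansion_coord_mult:
  fixes k :: "'d::finite"
  assumes f: "da_expansion f c"
  defines "d \<equiv> \<lambda>\<alpha>. if \<alpha> k = 0 then 0 else c (\<lambda>j. \<alpha> j - unit_idx k j)"
  shows "da_expansion (on_ball (\<lambda>z. z $ k) * f) d"
    and "(\<Sum>\<^sub>\<infinity>\<alpha>. da_weight \<alpha> * (cmod (d \<alpha>))\<^sup>2) \<le> (\<Sum>\<^sub>\<infinity>\<alpha>. da_weight \<alpha> * (cmod (c \<alpha>))\<^sup>2)"
proof -
  \<comment> \<open>Truncated subtraction inverts the shift exactly on these indices; elsewhere
    \<open>d\<close> is set to 0.\<close>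
  let ?S = "{\<alpha>. \<alpha> k > 0}"
  have bij: "bij_betw (\<lambda>\<alpha>. \<alpha> + unit_idx k) UNIV ?S"
    by (rule bij_betw_byWitness[where f' = "\<lambda>\<alpha>. \<lambda>j. \<alpha> j - unit_idx k j"])
      (auto simp: unit_idx_def fun_eq_iff)
  have d: "d (\<alpha> + unit_idx k) = c \<alpha>" for \<alpha>
    by (simp add: d_def unit_idx_def)
  have d0: "d \<alpha> = 0" if "\<alpha> \<notin> ?S" for \<alpha>
    using that by (simp add: d_def)
  have "((\<lambda>\<alpha>. d \<alpha> * mpow \<alpha> z) has_sum (z $ k * f z)) UNIV" if z: "z \<in> ball 0 1" for z
  proof -
    have "((\<lambda>\<alpha>. z $ k * (c \<alpha> * mpow \<alpha> z)) has_sum (z $ k * f z)) UNIV"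
      using f z by (intro has_sum_cmult_right) (auto simp: da_expansion_iff)
    then have "((\<lambda>\<alpha>. d (\<alpha> + unit_idx k) * mpow (\<alpha> + unit_idx k) z) has_sum (z $ k * f z)) UNIV"
      by (simp add: d mpow_add mult_ac)
    then have "((\<lambda>\<alpha>. d \<alpha> * mpow \<alpha> z) has_sum (z $ k * f z)) ?S"
      using has_sum_reindex_bij_betw[OF bij, of "\<lambda>\<alpha>. d \<alpha> * mpow \<alpha> z"] by blast
    then show ?thesis
      by (rule has_sum_cong_neutral[THEN iffD1, rotated -1]) (auto simp: d0)
  qed
  moreover
  have sc: "(\<lambda>\<alpha>. da_weight \<alpha> * (cmod (c \<alpha>))\<^sup>2) summable_on UNIV" using f by (simp add: da_expansion_iff)
  have le: "da_weight (\<alpha> + unit_idx k) * (cmod (c \<alpha>))\<^sup>2 \<le> da_weight \<alpha> * (cmod (c \<alpha>))\<^sup>2" for \<alpha>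
    by (intro mult_right_mono da_weight_add_unit_le) auto
  have s1: "(\<lambda>\<alpha>. da_weight (\<alpha> + unit_idx k) * (cmod (c \<alpha>))\<^sup>2) summable_on UNIV"
    by (rule summable_on_comparison_test[OF sc le]) auto
  define S where "S = (\<Sum>\<^sub>\<infinity>\<alpha>. da_weight (\<alpha> + unit_idx k) * (cmod (c \<alpha>))\<^sup>2)"
  have "((\<lambda>\<alpha>. da_weight (\<alpha> + unit_idx k) * (cmod (d (\<alpha> + unit_idx k)))\<^sup>2) has_sum S) UNIV"
    using has_sum_infsum[OF s1] by (simp add: d S_def)
  then have "((\<lambda>\<alpha>. da_weight \<alpha> * (cmod (d \<alpha>))\<^sup>2) has_sum S) ?S"
    using has_sum_reindex_bij_betw[OF bij, of "\<lambda>\<alpha>. da_weight \<alpha> * (cmod (d \<alpha>))\<^sup>2"] by blast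
  then have hS: "((\<lambda>\<alpha>. da_weight \<alpha> * (cmod (d \<alpha>))\<^sup>2) has_sum S) UNIV"
    by (rule has_sum_cong_neutral[THEN iffD1, rotated -1]) (auto simp: d0)
  ultimately show "da_expansion (on_ball (\<lambda>z. z $ k) * f) d"
    using has_sum_imp_summable[OF hS] by (auto simp: da_expansion_iff on_ball_def)
  have "S \<le> (\<Sum>\<^sub>\<infinity>\<alpha>. da_weight \<alpha> * (cmod (c \<alpha>))\<^sup>2)"
    unfolding S_def by (rule infsum_mono[OF s1 sc le])
  then show "(\<Sum>\<^sub>\<infinity>\<alpha>. da_weight \<alpha> * (cmod (d \<alpha>))\<^sup>2) \<le> (\<Sum>\<^sub>\<infinity>\<alpha>. da_weight \<alpha> * (cmod (c \<alpha>))\<^sup>2)"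
    using infsumI[OF hS] by simp
qed

lemma da_multipliers_coord: "on_ball (\<lambda>z. z $ k) \<in> da_multipliers"
proof -
  have "ip_norm da_inner (on_ball (\<lambda>z. z $ k) * f) \<le> 1 * ip_norm da_inner f"
    if f: "f \<in> drury_arveson" for f :: "complex^'a \<Rightarrow> complex"
  proof (rule power2_le_imp_le)
    note e = da_expansion_coord_mult[OF da_expansion_coeff[OF f], of k]
    show "(ip_norm da_inner (on_ball (\<lambda>z. z $ k) * f))\<^sup>2 \<le> (1 * ip_norm da_inner f)\<^sup>2"
      using e(2) by (simp add: da_norm_sq[OF drury_arvesonI[OF e(1)]] da_norm_sq[OF f] da_coeff_eq[OF e(1)])
  qed (use f in simp)
  moreover have "on_ball (\<lambda>z. z $ k) z = 0" if "z \<notin> ball 0 1" for z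
    using that by (simp add: on_ball_def)
  moreover have "on_ball (\<lambda>z. z $ k) * f \<in> drury_arveson" if "f \<in> drury_arveson" for f
    by (rule drury_arvesonI[OF da_expansion_coord_mult(1)[OF da_expansion_coeff[OF that]]])
  ultimately show ?thesis unfolding da_multipliers_def by blast
qed

text \<open>The product of the two absolutely convergent series, regrouped by the sum of the
  exponents, is a second expansion of \<open>f * g\<close>; uniqueness identifies the
  coefficients.\<close>

lemma da_coeff_mult:
  assumes "f \<in> drury_arveson" "g \<in> drury_arveson" "f * g \<in> drury_arveson"
  shows "da_coeff (f * g) \<gamma> = (\<Sum>p\<in>{p. fst p + snd p = \<gamma>}. da_coeff f (fst p) * da_coeff g (snd p))"
proof -
  define e where "e \<gamma> = (\<Sum>p\<in>{p. fst p + snd p = \<gamma>}. da_coeff f (fst p) * da_coeff g (snd p))" for \<gamma>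
  have "da_coeff (f * g) = e"
  proof (rule has_sum_ball_unique)
    fix z :: "complex^'a" assume z: "z \<in> ball 0 1"
    show "((\<lambda>\<alpha>. da_coeff (f * g) \<alpha> * mpow \<alpha> z) has_sum (f * g) z) UNIV"
      using da_expansion_coeff[OF assms(3)] z by (simp add: da_expansion_iff)
    have "((\<lambda>p. (da_coeff f (fst p) * mpow (fst p) z) * (da_coeff g (snd p) * mpow (snd p) z))
        has_sum f z * g z) (UNIV \<times> UNIV)"
      using da_expansion_coeff[OF assms(1)] da_expansion_coeff[OF assms(2)] z
      by (intro has_sum_product) (auto simp: da_expansion_iff)
    then have "((\<lambda>(\<gamma>, p). (da_coeff f (fst p) * da_coeff g (snd p)) * mpow \<gamma> z)
        has_sum f z * g z) (Sigma UNIV (\<lambda>\<gamma>. {p. fst p + snd p = \<gamma>}))"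
      by (subst has_sum_reindex_bij_witness[where j = snd and i = "\<lambda>p. (fst p + snd p, p)"
            and T = "UNIV \<times> UNIV" and h = "\<lambda>p. (da_coeff f (fst p) * mpow (fst p) z) *
              (da_coeff g (snd p) * mpow (snd p) z)", OF _ _ _ _ _ refl])
        (auto simp: mpow_add mult_ac)
    then have "((\<lambda>\<gamma>. e \<gamma> * mpow \<gamma> z) has_sum f z * g z) UNIV"
      by (rule has_sum_Sigma') (auto simp: e_def sum_distrib_right intro!: has_sum_finiteI)
    then show "((\<lambda>\<gamma>. e \<gamma> * mpow \<gamma> z) has_sum (f * g) z) UNIV" by simp
  qed
  then show ?thesis by (simp add: e_def)
qed

section \<open>Positive forms and powers of a nilpotent row contraction\<close>

definition psd_form :: "'a::complex_hilbert set \<Rightarrow> ('a \<Rightarrow> 'a \<Rightarrow> complex) \<Rightarrow> bool" where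
  "psd_form V B \<longleftrightarrow>
     (\<forall>x\<in>V. \<forall>y\<in>V. \<forall>z\<in>V. B (x + y) z = B x z + B y z) \<and>
     (\<forall>a. \<forall>x\<in>V. \<forall>y\<in>V. B (a *\<^sub>C x) y = a * B x y) \<and>
     (\<forall>x\<in>V. \<forall>y\<in>V. B y x = cnj (B x y)) \<and> (\<forall>x\<in>V. 0 \<le> Re (B x x))"

lemma psd_formD:
  assumes "psd_form V B"
  shows "x \<in> V \<Longrightarrow> y \<in> V \<Longrightarrow> z \<in> V \<Longrightarrow> B (x + y) z = B x z + B y z"
    and "x \<in> V \<Longrightarrow> y \<in> V \<Longrightarrow> B (a *\<^sub>C x) y = a * B x y"
    and "x \<in> V \<Longrightarrow> y \<in> V \<Longrightarrow> B y x = cnj (B x y)"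
    and "x \<in> V \<Longrightarrow> 0 \<le> Re (B x x)"
  using assms unfolding psd_form_def by blast+

lemma psd_form_self:
  assumes "psd_form V B" "x \<in> V"
  shows "B x x = of_real (Re (B x x))"
proof -
  have "B x x = cnj (B x x)" using psd_formD(3)[OF assms(1,2,2)] .
  then show ?thesis by (simp add: complex_eq_iff)
qed

lemma psd_form_shift:
  assumes V: "csubspace V" and B: "psd_form V B" and x: "x \<in> V" and h: "h \<in> V"
  shows "B (x + a *\<^sub>C h) (x + a *\<^sub>C h) =
    B x x + a * cnj (B x h) + cnj a * B x h + a * cnj a * B h h"
proof -
  note [simp] = csubspace_add[OF V] csubspace_scaleC[OF V] x h
  have *: "B u (x + a *\<^sub>C h) = B u x + cnj a * B u h" if u: "u \<in> V" for u
  proof -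
    have "B u (x + a *\<^sub>C h) = cnj (B (x + a *\<^sub>C h) u)" by (rule psd_formD(3)[OF B]) (use u in auto)
    also have "\<dots> = cnj (B x u) + cnj a * cnj (B h u)" by (simp add: psd_formD(1,2)[OF B] u)
    also have "\<dots> = B u x + cnj a * B u h"
      using psd_formD(3)[OF B x u] psd_formD(3)[OF B h u] by simp
    finally show ?thesis .
  qed
  have "B (x + a *\<^sub>C h) (x + a *\<^sub>C h) = B x (x + a *\<^sub>C h) + a * B h (x + a *\<^sub>C h)"
    by (simp add: psd_formD(1,2)[OF B])
  then show ?thesis using psd_formD(3)[OF B x h] by (simp add: * algebra_simps)
qed

text \<open>If h is null but not orthogonal to x, the form at x + a h is affine in a suitable real
  direction of a with nonzero slope, and so becomes negative.\<close>

lemma psd_form_null: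
  assumes V: "csubspace V" and B: "psd_form V B" and x: "x \<in> V" and h: "h \<in> V" and "B h h = 0"
  shows "B x h = 0"
proof (rule ccontr)
  define b where "b = B x h"
  assume "B x h \<noteq> 0"
  then have b: "(cmod b)\<^sup>2 > 0" by (simp add: b_def)
  \<comment> \<open>Chosen to make the value at the shifted vector exactly -1.\<close>
  define t where "t = (Re (B x x) + 1) / (2 * (cmod b)\<^sup>2)"
  have "B (x + (- of_real t * b) *\<^sub>C h) (x + (- of_real t * b) *\<^sub>C h) = B x x - of_real (2 * t) * (b * cnj b)"
    unfolding psd_form_shift[OF V B x h] using assms(5) by (simp add: b_def[symmetric] algebra_simps)
  then have "Re (B (x + (- of_real t * b) *\<^sub>C h) (x + (- of_real t * b) *\<^sub>C h)) = Re (B x x) - 2 * t * (cmod b)\<^sup>2"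
    by (simp add: complex_norm_square[symmetric] flip: of_real_mult of_real_power)
  also have "2 * t * (cmod b)\<^sup>2 = Re (B x x) + 1" using b by (simp add: t_def)
  finally show False
    using psd_formD(4)[OF B csubspace_add[OF V x csubspace_scaleC[OF V h]], of "- of_real t * b"]
    by linarith
qed

text \<open>One Gram--Schmidt step: subtracting the component along \<open>h\<close> keeps the form positive and puts
  \<open>h\<close> in its null space. If \<open>B h h = 0\<close>, division by zero makes the subtracted term vanish.\<close>

lemma psd_form_reduce:
  assumes V: "csubspace V" and B: "psd_form V B" and h: "h \<in> V"
  shows "psd_form V (\<lambda>x y. B x y - B x h * B h y / B h h)"
proof -
  have "0 \<le> Re (B x x - B x h * B h x / B h h)" if x: "x \<in> V" for x
  proof (cases "B h h = 0")
    case True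
    then show ?thesis using psd_formD(4)[OF B x] by simp
  next
    case False
    \<comment> \<open>The minimiser of the form along x + a h; its minimal value is the reduced form
      at x.\<close>
    define a where "a = - B x h / B h h"
    have ca: "cnj a = - cnj (B x h) / B h h"
      using psd_formD(3)[OF B h h] by (simp add: a_def)
    have "B (x + a *\<^sub>C h) (x + a *\<^sub>C h) = B x x - B x h * B h x / B h h"
      unfolding psd_form_shift[OF V B x h] ca psd_formD(3)[OF B x h]
      using False by (simp add: a_def)
    then show ?thesis using psd_formD(4)[OF B csubspace_add[OF V x csubspace_scaleC[OF V h]], of a] by simp
  qed
  moreover have "cnj (B x y - B x h * B h y / B h h) = B y x - B y h * B h x / B h h"
    if "x \<in> V" "y \<in> V" for x y
    using psd_formD(3)[OF B that] psd_formD(3)[OF B h that(2)] psd_formD(3)[OF B that(1) h]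
      psd_formD(3)[OF B h h] by simp
  ultimately show ?thesis
    using h unfolding psd_form_def
    by (auto simp: psd_formD(1,2)[OF B] algebra_simps add_divide_distrib)
qed

text \<open>Induction on the finite set: each vector splits off one rank-one term, which becomes a
  new coordinate of the factorization. The \<open>f s\<close> are mere functions on the chosen
  points, with no linearity claimed.\<close>

lemma gram_factorization:
  fixes V :: "'a::complex_hilbert set"
  assumes V: "csubspace V" and "finite X" "X \<subseteq> V" "psd_form V B"
  shows "\<exists>(r::nat) f. \<forall>x\<in>X. \<forall>y\<in>X. B x y = (\<Sum>s<r. f s x * cnj (f s y))"
  using assms(2-)
proof (induction X arbitrary: B rule: finite_induct)
  case (insert h X)
  then have h: "h \<in> V" and XV: "X \<subseteq> V" and B: "psd_form V B" by auto
  define B' where "B' = (\<lambda>x y. B x y - B x h * B h y / B h h)"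
  obtain r :: nat and f where f: "\<forall>x\<in>X. \<forall>y\<in>X. B' x y = (\<Sum>s<r. f s x * cnj (f s y))"
    using insert.IH[OF XV psd_form_reduce[OF V B h]] unfolding B'_def by blast
  have null: "B' x h = 0" "B' h x = 0" if x: "x \<in> V" for x
  proof -
    show "B' x h = 0" using psd_form_null[OF V B x h] by (auto simp: B'_def)
    then have "cnj (B' x h) = 0" by simp
    then show "B' h x = 0" using psd_formD(3)[OF psd_form_reduce[OF V B h] x h] by (simp add: B'_def)
  qed
  \<comment> \<open>If \<open>B h h = 0\<close> then \<open>q = 0\<close>, and division by zero
    makes the new coordinate vanish, in agreement with the vanishing term subtracted in
    \<open>B'\<close>.\<close>
  define q where "q = complex_of_real (sqrt (Re (B h h)))"
  have q: "q * cnj q = B h h"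
    using psd_formD(4)[OF B h] psd_form_self[OF B h]
    by (simp add: q_def flip: of_real_mult)
  \<comment> \<open>The new coordinate \<open>r\<close> carries the removed term. The old
    coordinates are set to 0 at \<open>h\<close>, because \<open>h\<close> is null for
    \<open>B'\<close> while the induction hypothesis says nothing about \<open>f\<close>
    there.\<close>
  define g where "g s x = (if s = r then B x h / q else if x = h then 0 else f s x)" for s x
  have "B x y = (\<Sum>s<Suc r. g s x * cnj (g s y))" if x: "x \<in> insert h X" and y: "y \<in> insert h X" for x y
  proof -
    have xy: "x \<in> V" "y \<in> V" using x y h XV by auto
    have "(\<Sum>s<r. g s x * cnj (g s y)) = B' x y"
    proof (cases "x = h \<or> y = h")
      case True
      then show ?thesis using null xy by (auto simp: g_def)
    next
      case False
      then show ?thesis using f x y by (auto simp: g_def)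
    qed
    moreover have "g r x * cnj (g r y) = B x h * B h y / B h h"
      using q psd_formD(3)[OF B xy(2) h] by (simp add: g_def)
    ultimately show ?thesis by (simp add: B'_def)
  qed
  then show ?case by blast
qed simp

section \<open>Multi-index powers of a commuting tuple\<close>

declare plus_fun_apply [simp del] zero_fun_apply [simp del]

text \<open>The exponent function is read as a finite multiset of variables, each of which is
  applied with its multiplicity. For commuting operators the order is irrelevant, so no enumeration
  of the index type has to be chosen.\<close>

definition op_pow :: "('d::finite \<Rightarrow> 'a \<Rightarrow> 'a) \<Rightarrow> ('d \<Rightarrow> nat) \<Rightarrow> 'a \<Rightarrow> 'a" where
  "op_pow S \<alpha> x = fold_mset S x (Abs_multiset \<alpha>)"

lemma op_pow_0 [simp]: "op_pow S 0 x = x" for S :: "'d::finite \<Rightarrow> 'a \<Rightarrow> 'a"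
proof -
  have "Abs_multiset (0 :: 'd \<Rightarrow> nat) = {#}" by (simp add: zero_multiset_def zero_fun_def)
  then show ?thesis unfolding op_pow_def by (simp only: fold_mset_empty)
qed

lemma op_pow_add_unit:
  assumes "\<And>j k x. S j (S k x) = S k (S j x)"
  shows "op_pow S (\<alpha> + unit_idx k) x = S k (op_pow S \<alpha> x)"
proof -
  interpret comp_fun_commute S by standard (use assms in auto)
  have "Abs_multiset (\<alpha> + unit_idx k) = add_mset k (Abs_multiset \<alpha>)"
    by (rule multiset_eqI) (simp add: Abs_multiset_inverse unit_idx_def plus_fun_apply)
  then show ?thesis by (simp add: op_pow_def)
qed

lemma op_pow_unit_commute:
  assumes S: "\<And>j k x. S j (S k x) = S k (S j x)"
  shows "op_pow S \<alpha> (S k x) = S k (op_pow S \<alpha> x)"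
  by (induction \<alpha> rule: midx_induct) (simp_all add: op_pow_add_unit[of S, OF S] S)

lemma op_pow_add:
  assumes S: "\<And>j k x. S j (S k x) = S k (S j x)"
  shows "op_pow S (\<alpha> + \<beta>) x = op_pow S \<alpha> (op_pow S \<beta> x)"
proof (induction \<beta> rule: midx_induct)
  case (add_unit \<beta> k)
  have "op_pow S (\<alpha> + (\<beta> + unit_idx k)) x = S k (op_pow S (\<alpha> + \<beta>) x)"
    using op_pow_add_unit[of S, OF S, of "\<alpha> + \<beta>" k x] by (simp add: add.assoc)
  with add_unit show ?case by (simp add: op_pow_add_unit[of S, OF S] op_pow_unit_commute[of S, OF S])
qed simp

text \<open>Lets a vanishing power of a single operator kill every monomial that contains
  it.\<close>

lemma op_pow_funpow:
  assumes S: "\<And>j k x. S j (S k x) = S k (S j x)"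
  shows "m \<le> \<alpha> k \<Longrightarrow> \<exists>\<beta>. \<forall>x. op_pow S \<alpha> x = op_pow S \<beta> ((S k ^^ m) x)"
proof (induction m arbitrary: \<alpha>)
  case (Suc m)
  then obtain \<beta> where \<beta>: "\<alpha> = \<beta> + unit_idx k" using unit_idx_decomp[of \<alpha> k] by auto
  then have "m \<le> \<beta> k" using Suc.prems by (simp add: unit_idx_def plus_fun_apply)
  then obtain \<beta>' where "\<forall>x. op_pow S \<beta> x = op_pow S \<beta>' ((S k ^^ m) x)" using Suc.IH by blast
  then have "op_pow S \<alpha> x = op_pow S \<beta>' ((S k ^^ Suc m) x)" for x
    unfolding \<beta> op_pow_add_unit[of S, OF S] by (simp add: funpow_swap1 flip: op_pow_unit_commute[of S, OF S])
  then show ?case by blast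
qed auto

text \<open>The carrier is a parameter because everything is used twice: for T on the whole space
  and for its restriction to M.\<close>

locale nilpotent_row =
  fixes V :: "'a::complex_hilbert set" and T :: "'d::finite \<Rightarrow> 'a \<Rightarrow> 'a"
  assumes V: "csubspace V" "closed V"
    and row: "row_contraction V T" and comm: "commuting V T" and nil: "nilpotent V T"
begin

lemma T_bounded: "T k \<in> bounded_ops V"
  using row by (simp add: row_contraction_def)

text \<open>Off \<open>V\<close> both sides are 0 by the extension convention, so commutation holds
  at every point, as the \<open>op_pow\<close> lemmas require.\<close>

lemma T_commute: "T j (T k x) = T k (T j x)"
proof (cases "x \<in> V")
  case True
  then show ?thesis using comm by (simp add: commuting_def)
next
  case False
  then show ?thesis by (simp add: bounded_opsD(2)[OF T_bounded] bounded_ops_0[OF T_bounded V(1)])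
qed

lemmas T_pow_add_unit = op_pow_add_unit[of T, OF T_commute]
  and T_pow_add = op_pow_add[of T, OF T_commute]
  and T_pow_commute = op_pow_unit_commute[of T, OF T_commute]

lemma T_pow_bounded:
  shows T_pow_in: "x \<in> V \<Longrightarrow> op_pow T \<alpha> x \<in> V"
    and T_pow_plus: "x \<in> V \<Longrightarrow> y \<in> V \<Longrightarrow> op_pow T \<alpha> (x + y) = op_pow T \<alpha> x + op_pow T \<alpha> y"
    and T_pow_scaleC: "x \<in> V \<Longrightarrow> op_pow T \<alpha> (a *\<^sub>C x) = a *\<^sub>C op_pow T \<alpha> x"
    and T_pow_bound: "\<exists>K. \<forall>x\<in>V. norm (op_pow T \<alpha> x) \<le> K * norm x"
proof -
  have *: "(\<forall>x\<in>V. op_pow T \<alpha> x \<in> V) \<and>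
    (\<forall>x\<in>V. \<forall>y\<in>V. op_pow T \<alpha> (x + y) = op_pow T \<alpha> x + op_pow T \<alpha> y) \<and>
    (\<forall>a. \<forall>x\<in>V. op_pow T \<alpha> (a *\<^sub>C x) = a *\<^sub>C op_pow T \<alpha> x) \<and>
    (\<exists>K. \<forall>x\<in>V. norm (op_pow T \<alpha> x) \<le> K * norm x)"
  proof (induction \<alpha> rule: midx_induct)
    case zero
    show ?case by (auto intro: exI[of _ 1])
  next
    case (add_unit \<alpha> k)
    obtain K where K: "\<forall>x\<in>V. norm (op_pow T \<alpha> x) \<le> K * norm x" using add_unit by blast
    obtain M where M: "\<forall>x\<in>V. norm (T k x) \<le> M * norm x" using bounded_opsD(5)[OF T_bounded] by blast
    have "norm (T k (op_pow T \<alpha> x)) \<le> (\<bar>M\<bar> * K) * norm x" if x: "x \<in> V" for x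
    proof -
      have "norm (T k (op_pow T \<alpha> x)) \<le> M * norm (op_pow T \<alpha> x)" using M add_unit x by blast
      also have "\<dots> \<le> \<bar>M\<bar> * (K * norm x)" using K x by (intro mult_mono) auto
      finally show ?thesis by (simp add: mult.assoc)
    qed
    with add_unit show ?case
      by (auto simp: T_pow_add_unit bounded_opsD[OF T_bounded])
  qed
  show "x \<in> V \<Longrightarrow> op_pow T \<alpha> x \<in> V"
    "x \<in> V \<Longrightarrow> y \<in> V \<Longrightarrow> op_pow T \<alpha> (x + y) = op_pow T \<alpha> x + op_pow T \<alpha> y"
    "x \<in> V \<Longrightarrow> op_pow T \<alpha> (a *\<^sub>C x) = a *\<^sub>C op_pow T \<alpha> x"
    "\<exists>K. \<forall>x\<in>V. norm (op_pow T \<alpha> x) \<le> K * norm x" using * by auto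
qed

lemma T_pow_zero: "op_pow T \<alpha> 0 = 0"
  using T_pow_scaleC[OF csubspace_0[OF V(1)], of \<alpha> 0] by simp

lemma T_pow_sum:
  "(\<And>i. i \<in> I \<Longrightarrow> f i \<in> V) \<Longrightarrow> op_pow T \<alpha> (\<Sum>i\<in>I. f i) = (\<Sum>i\<in>I. op_pow T \<alpha> (f i))"
proof (induction I rule: infinite_finite_induct)
  case (insert i I)
  then show ?case using T_pow_plus[of "f i" "sum f I"] csubspace_sum[OF V(1), of I f] by simp
qed (simp_all add: T_pow_zero)

text \<open>Pigeonhole: once the total degree exceeds the sum of the nilpotency exponents, some
  entry reaches its own exponent.\<close>

lemma nilpotency_degree: "\<exists>L. \<forall>\<alpha>. L \<le> mdeg \<alpha> \<longrightarrow> (\<forall>x\<in>V. op_pow T \<alpha> x = 0)"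
proof -
  have "\<forall>k. \<exists>m. \<forall>x\<in>V. (T k ^^ m) x = 0" using nil by (simp add: nilpotent_def)
  from choice[OF this] obtain m where m: "\<forall>k. \<forall>x\<in>V. (T k ^^ m k) x = 0" by blast
  have "op_pow T \<alpha> x = 0" if \<alpha>: "Suc (\<Sum>k\<in>UNIV. m k) \<le> mdeg \<alpha>" and x: "x \<in> V" for \<alpha> x
  proof -
    have "\<exists>k. m k \<le> \<alpha> k"
    proof (rule ccontr)
      assume "\<nexists>k. m k \<le> \<alpha> k"
      then have "mdeg \<alpha> \<le> (\<Sum>k\<in>UNIV. m k)" unfolding mdeg_def
        by (intro sum_mono) (simp add: not_le less_imp_le)
      with \<alpha> show False by simp
    qed
    then obtain k where "m k \<le> \<alpha> k" ..
    then obtain \<beta> where "\<forall>x. op_pow T \<alpha> x = op_pow T \<beta> ((T k ^^ m k) x)"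
      using op_pow_funpow[of T, OF T_commute] by blast
    then show ?thesis using m x T_pow_zero by simp
  qed
  then show ?thesis by blast
qed

definition nil_deg :: nat where
  "nil_deg = (SOME L. \<forall>\<alpha>. L \<le> mdeg \<alpha> \<longrightarrow> (\<forall>x\<in>V. op_pow T \<alpha> x = 0))"

text \<open>The cutoff is by total degree rather than by the indices with nonzero power: this shape
  fits both the truncated Cauchy product and the telescoping over degrees.\<close>

definition F :: "('d \<Rightarrow> nat) set" where
  "F = deg_below nil_deg"

lemma finite_F [simp]: "finite F"
  by (simp add: F_def)

lemma T_pow_outside: "\<alpha> \<notin> F \<Longrightarrow> x \<in> V \<Longrightarrow> op_pow T \<alpha> x = 0"
  using someI_ex[OF nilpotency_degree] by (auto simp: F_def deg_below_def nil_deg_def not_less)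

section \<open>Powers of the adjoint tuple and the defect form\<close>

definition A :: "'d \<Rightarrow> 'a \<Rightarrow> 'a" where
  "A k = op_adjoint V (T k)"

lemma A_in: "A k x \<in> V"
  using op_adjoint_in[OF V T_bounded] csubspace_0[OF V(1)]
  by (cases "x \<in> V") (auto simp: A_def op_adjoint_outside)

lemma cinner_A: "x \<in> V \<Longrightarrow> y \<in> V \<Longrightarrow> cinner (T k x) y = cinner x (A k y)"
  unfolding A_def by (rule cinner_op_adjoint[OF V T_bounded])

lemma A_plus: "x \<in> V \<Longrightarrow> y \<in> V \<Longrightarrow> A k (x + y) = A k x + A k y"
  unfolding A_def by (rule op_adjoint_linear[OF V T_bounded])

lemma A_scaleC: "x \<in> V \<Longrightarrow> A k (a *\<^sub>C x) = a *\<^sub>C A k x"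
  unfolding A_def by (rule op_adjoint_linear[OF V T_bounded])

lemma A_commute: "A j (A k x) = A k (A j x)"
proof (cases "x \<in> V")
  case True
  show ?thesis
  proof (rule eq_if_cinner_eq[OF V(1) A_in A_in])
    fix u assume u: "u \<in> V"
    then show "cinner u (A j (A k x)) = cinner u (A k (A j x))"
      by (simp add: cinner_A[symmetric] A_in True bounded_opsD(1)[OF T_bounded] T_commute)
  qed
next
  case False
  then have "A k x = 0" for k by (simp add: A_def op_adjoint_outside)
  moreover have "A k 0 = 0" for k using A_scaleC[OF csubspace_0[OF V(1)], of k 0] by simp
  ultimately show ?thesis by simp
qed

lemmas A_pow_add_unit = op_pow_add_unit[of A, OF A_commute]
  and A_pow_add = op_pow_add[of A, OF A_commute]
  and A_pow_commute = op_pow_unit_commute[of A, OF A_commute]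

lemma A_pow_in: "x \<in> V \<Longrightarrow> op_pow A \<alpha> x \<in> V"
  by (induction \<alpha> rule: midx_induct) (auto simp: A_pow_add_unit A_in)

lemma cinner_A_pow:
  "x \<in> V \<Longrightarrow> y \<in> V \<Longrightarrow> cinner (op_pow T \<alpha> x) y = cinner x (op_pow A \<alpha> y)"
proof (induction \<alpha> arbitrary: y rule: midx_induct)
  case (add_unit \<alpha> k)
  then show ?case by (simp add: T_pow_add_unit cinner_A T_pow_in A_in A_pow_add_unit A_pow_commute)
qed simp

lemma A_pow_outside: "\<alpha> \<notin> F \<Longrightarrow> y \<in> V \<Longrightarrow> op_pow A \<alpha> y = 0"
  using eq_if_cinner_eq[OF V(1) A_pow_in csubspace_0[OF V(1)], of y \<alpha>]
  by (simp add: cinner_A_pow[symmetric] T_pow_outside)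

text \<open>On \<open>V\<close>, the sesquilinear form of I - sum T_k T_k^* with each T_k moved to
  the other side. Being a row contraction is exactly its positivity.\<close>

definition defect :: "'a \<Rightarrow> 'a \<Rightarrow> complex" where
  "defect x y = cinner x y - (\<Sum>k\<in>UNIV. cinner (A k x) (A k y))"

lemma psd_defect: "psd_form V defect"
proof -
  have "0 \<le> Re (defect x x)" if x: "x \<in> V" for x
  proof -
    have "cinner (x - (\<Sum>k\<in>UNIV. T k (A k x))) x \<in> \<real>\<^sub>\<ge>\<^sub>0"
      using row x unfolding row_contraction_def A_def by blast
    moreover have "cinner (x - (\<Sum>k\<in>UNIV. T k (A k x))) x = defect x x"
      by (simp add: defect_def cinner_diff_left cinner_sum_left cinner_A A_in x)
    ultimately show ?thesis by (simp add: complex_nonneg_Reals_iff)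
  qed
  moreover have "defect y x = cnj (defect x y)" for x y
    by (simp add: defect_def cnj_cinner)
  moreover have plus: "defect (x + y) z = defect x z + defect y z" if "x \<in> V" "y \<in> V" for x y z
    using that by (simp add: defect_def A_plus cinner_add_left sum.distrib)
  moreover have scale: "defect (a *\<^sub>C x) y = a * defect x y" if "x \<in> V" for a x y
    using that by (simp add: defect_def A_scaleC cinner_scaleC_left right_diff_distrib sum_distrib_left)
  ultimately show ?thesis unfolding psd_form_def
    by (blast intro: plus scale)
qed

end

section \<open>The polynomial calculus as a compression\<close>

lemma finite_mdeg_eq [simp]: "finite {\<alpha> :: 'd::finite \<Rightarrow> nat. mdeg \<alpha> = n}"
  by (rule finite_subset[OF _ finite_deg_below[of "Suc n"]]) (auto simp: deg_below_def)

text \<open>The reciprocal weights \<open>|\<alpha>|! / \<alpha>!\<close> are multinomial coefficients; this is their Pascal rule.\<close>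

lemma sum_weights_pascal:
  fixes G :: "('d::finite \<Rightarrow> nat) \<Rightarrow> complex"
  shows "(\<Sum>k\<in>UNIV. \<Sum>\<alpha>\<in>{\<alpha>. mdeg \<alpha> = n}. G (\<alpha> + unit_idx k) / da_weight \<alpha>) =
    (\<Sum>\<gamma>\<in>{\<gamma>. mdeg \<gamma> = Suc n}. G \<gamma> / da_weight \<gamma>)"
proof -
  \<comment> \<open>The share of the term at \<open>\<gamma>\<close> that arrives from direction
    \<open>k\<close>. The shares sum to 1 because the entries of \<open>\<gamma>\<close> sum to n +
    1, and indices with \<open>\<gamma> k = 0\<close> contribute nothing.\<close>
  define H where "H k \<gamma> = G \<gamma> / da_weight \<gamma> * (of_nat (\<gamma> k) / of_nat (Suc n))" for k :: 'd and \<gamma>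
  have "(\<Sum>\<alpha>\<in>{\<alpha>. mdeg \<alpha> = n}. G (\<alpha> + unit_idx k) / da_weight \<alpha>) =
      (\<Sum>\<gamma>\<in>{\<gamma>. mdeg \<gamma> = Suc n}. H k \<gamma>)" for k
  proof -
    have "(\<Sum>\<alpha>\<in>{\<alpha>. mdeg \<alpha> = n}. G (\<alpha> + unit_idx k) / da_weight \<alpha>) =
        (\<Sum>\<alpha>\<in>{\<alpha>. mdeg \<alpha> = n}. H k (\<alpha> + unit_idx k))"
    proof (rule sum.cong)
      fix \<alpha> :: "'d \<Rightarrow> nat" assume "\<alpha> \<in> {\<alpha>. mdeg \<alpha> = n}"
      then have "mdeg \<alpha> = n" by simp
      moreover have "complex_of_real (da_weight \<alpha>) \<noteq> 0" using da_weight_pos[of \<alpha>] by simp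
      moreover have "(\<alpha> + unit_idx k) k = Suc (\<alpha> k)" by (simp add: plus_fun_apply unit_idx_def)
      moreover have "1 + complex_of_nat m \<noteq> 0" for m using of_nat_neq_0[of m, where 'a = complex] by simp
      ultimately show "G (\<alpha> + unit_idx k) / da_weight \<alpha> = H k (\<alpha> + unit_idx k)"
        by (simp add: H_def da_weight_add_unit)
    qed simp
    also have "\<dots> = (\<Sum>\<gamma>\<in>{\<gamma>. mdeg \<gamma> = Suc n \<and> \<gamma> k > 0}. H k \<gamma>)"
    proof (rule sum.reindex_bij_witness[of _ "\<lambda>\<gamma> j. \<gamma> j - unit_idx k j" "\<lambda>\<alpha>. \<alpha> + unit_idx k"])
      fix \<gamma> :: "'d \<Rightarrow> nat" assume \<gamma>: "\<gamma> \<in> {\<gamma>. mdeg \<gamma> = Suc n \<and> \<gamma> k > 0}"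
      then show e: "(\<lambda>j. \<gamma> j - unit_idx k j) + unit_idx k = \<gamma>"
        by (auto simp: unit_idx_def plus_fun_apply fun_eq_iff)
      then show "(\<lambda>j. \<gamma> j - unit_idx k j) \<in> {\<alpha>. mdeg \<alpha> = n}"
        using \<gamma> mdeg_add[of "\<lambda>j. \<gamma> j - unit_idx k j" "unit_idx k"] by simp
    next
      fix \<alpha> :: "'d \<Rightarrow> nat"
      show "(\<lambda>j. (\<alpha> + unit_idx k) j - unit_idx k j) = \<alpha>" by (simp add: plus_fun_apply)
      have "0 < (\<alpha> + unit_idx k) k" by (simp add: plus_fun_apply unit_idx_def)
      then show "\<alpha> \<in> {\<alpha>. mdeg \<alpha> = n} \<Longrightarrow> \<alpha> + unit_idx k \<in> {\<gamma>. mdeg \<gamma> = Suc n \<and> \<gamma> k > 0}"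
        by (simp add: mdeg_add)
    qed simp
    also have "\<dots> = (\<Sum>\<gamma>\<in>{\<gamma>. mdeg \<gamma> = Suc n}. H k \<gamma>)"
      by (rule sum.mono_neutral_left) (auto simp: H_def)
    finally show ?thesis .
  qed
  then have "(\<Sum>k\<in>UNIV. \<Sum>\<alpha>\<in>{\<alpha>. mdeg \<alpha> = n}. G (\<alpha> + unit_idx k) / da_weight \<alpha>) =
      (\<Sum>\<gamma>\<in>{\<gamma>. mdeg \<gamma> = Suc n}. \<Sum>k\<in>UNIV. H k \<gamma>)"
    by (simp add: sum.swap[of _ UNIV])
  also have "\<dots> = (\<Sum>\<gamma>\<in>{\<gamma>. mdeg \<gamma> = Suc n}. G \<gamma> / da_weight \<gamma>)"
  proof (rule sum.cong)
    fix \<gamma> :: "'d \<Rightarrow> nat" assume "\<gamma> \<in> {\<gamma>. mdeg \<gamma> = Suc n}"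
    then have "(\<Sum>k\<in>UNIV. complex_of_nat (\<gamma> k)) = of_nat (Suc n)"
      unfolding mdeg_def by (simp only: of_nat_sum[symmetric] mem_Collect_eq)
    then have "(\<Sum>k\<in>UNIV. complex_of_nat (\<gamma> k) / of_nat (Suc n)) = 1"
      unfolding sum_divide_distrib[symmetric] using of_nat_neq_0[of n, where 'a = complex] by simp
    then show "(\<Sum>k\<in>UNIV. H k \<gamma>) = G \<gamma> / da_weight \<gamma>"
      unfolding H_def sum_distrib_left[symmetric] by simp
  qed simp
  finally show ?thesis .
qed

context nilpotent_row
begin

lemma sum_splits_F:
  "(\<Sum>\<gamma>\<in>F. \<Sum>p\<in>{p. fst p + snd p = \<gamma>}. G p) =
   (\<Sum>\<alpha>\<in>F. \<Sum>\<beta>\<in>F. if \<alpha> + \<beta> \<in> F then G (\<alpha>, \<beta>) else 0)"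
  unfolding F_def by (rule sum_splits_deg_below)

text \<open>Telescoping: by the Pascal rule, the adjoints inside the defect raise the degree-n block
  to the degree-(n+1) block, so the defects of degree n form the difference of consecutive
  blocks.\<close>

lemma sum_defect_deg_below:
  "(\<Sum>\<alpha>\<in>deg_below n. defect (op_pow A \<alpha> x) (op_pow A \<alpha> y) / da_weight \<alpha>) =
   cinner x y - (\<Sum>\<alpha>\<in>{\<alpha>. mdeg \<alpha> = n}. cinner (op_pow A \<alpha> x) (op_pow A \<alpha> y) / da_weight \<alpha>)"
proof (induction n)
  case 0
  have "{\<alpha> :: 'd \<Rightarrow> nat. mdeg \<alpha> = 0} = {0}" by (auto simp: mdeg_eq_0_iff)
  then show ?case by (simp add: deg_below_def da_weight_def zero_fun_def[symmetric] zero_fun_apply)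
next
  case (Suc n)
  let ?c = "\<lambda>\<alpha>. cinner (op_pow A \<alpha> x) (op_pow A \<alpha> y)"
  have "deg_below (Suc n) = deg_below n \<union> {\<alpha> :: 'd \<Rightarrow> nat. mdeg \<alpha> = n}"
    by (auto simp: deg_below_def)
  then have "(\<Sum>\<alpha>\<in>deg_below (Suc n). defect (op_pow A \<alpha> x) (op_pow A \<alpha> y) / da_weight \<alpha>) =
      (\<Sum>\<alpha>\<in>deg_below n. defect (op_pow A \<alpha> x) (op_pow A \<alpha> y) / da_weight \<alpha>) +
      (\<Sum>\<alpha>\<in>{\<alpha>. mdeg \<alpha> = n}. defect (op_pow A \<alpha> x) (op_pow A \<alpha> y) / da_weight \<alpha>)"
    by (simp only:) (rule sum.union_disjoint[OF finite_deg_below finite_mdeg_eq], auto simp: deg_below_def)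
  also have "(\<Sum>\<alpha>\<in>{\<alpha>. mdeg \<alpha> = n}. defect (op_pow A \<alpha> x) (op_pow A \<alpha> y) / da_weight \<alpha>) =
      (\<Sum>\<alpha>\<in>{\<alpha>. mdeg \<alpha> = n}. ?c \<alpha> / da_weight \<alpha>) -
      (\<Sum>\<alpha>\<in>{\<alpha>. mdeg \<alpha> = n}. \<Sum>k\<in>UNIV. ?c (\<alpha> + unit_idx k) / da_weight \<alpha>)"
    by (simp add: defect_def A_pow_add_unit diff_divide_distrib sum_divide_distrib sum_subtractf)
  also have "(\<Sum>\<alpha>\<in>{\<alpha>. mdeg \<alpha> = n}. \<Sum>k\<in>UNIV. ?c (\<alpha> + unit_idx k) / da_weight \<alpha>) =
      (\<Sum>\<gamma>\<in>{\<gamma>. mdeg \<gamma> = Suc n}. ?c \<gamma> / da_weight \<gamma>)"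
    by (subst sum.swap) (rule sum_weights_pascal)
  finally show ?case using Suc.IH by simp
qed

text \<open>The remainder block has degree \<open>nil_deg\<close>, where all adjoint powers vanish.
  Recovering the whole inner product is what makes the Poisson kernel isometric.\<close>

lemma sum_defect:
  assumes "x \<in> V" "y \<in> V"
  shows "(\<Sum>\<alpha>\<in>F. defect (op_pow A \<alpha> x) (op_pow A \<alpha> y) / da_weight \<alpha>) = cinner x y"
proof -
  have "cinner (op_pow A \<alpha> x) (op_pow A \<alpha> y) = 0" if "mdeg \<alpha> = nil_deg" for \<alpha>
    using A_pow_outside[of \<alpha> x] assms that by (simp add: F_def deg_below_def)
  then show ?thesis unfolding F_def sum_defect_deg_below by simp
qed

lemma defect_zero_right: "defect u 0 = 0"
proof -
  have "A k 0 = 0" for k using A_scaleC[OF csubspace_0[OF V(1)], of k 0] by simp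
  then show ?thesis by (simp add: defect_def)
qed

section \<open>The truncated Taylor calculus and its algebraic properties\<close>

definition calc :: "(complex^'d \<Rightarrow> complex) \<Rightarrow> 'a \<Rightarrow> 'a" where
  "calc \<phi> = op_restrict V (\<lambda>x. \<Sum>\<alpha>\<in>F. da_coeff \<phi> \<alpha> *\<^sub>C op_pow T \<alpha> x)"

lemma calc_apply: "x \<in> V \<Longrightarrow> calc \<phi> x = (\<Sum>\<alpha>\<in>F. da_coeff \<phi> \<alpha> *\<^sub>C op_pow T \<alpha> x)"
  by (simp add: calc_def op_restrict_def)

lemma calc_in: "x \<in> V \<Longrightarrow> calc \<phi> x \<in> V"
  by (simp add: calc_apply csubspace_sum csubspace_scaleC V T_pow_in)

lemma calc_bounded: "calc \<phi> \<in> bounded_ops V"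
proof -
  have "\<forall>\<alpha>. \<exists>K. \<forall>x\<in>V. norm (op_pow T \<alpha> x) \<le> K * norm x" using T_pow_bound by blast
  from choice[OF this] obtain K where K: "\<And>\<alpha> x. x \<in> V \<Longrightarrow> norm (op_pow T \<alpha> x) \<le> K \<alpha> * norm x"
    by blast
  have "norm (calc \<phi> x) \<le> (\<Sum>\<alpha>\<in>F. cmod (da_coeff \<phi> \<alpha>) * K \<alpha>) * norm x" if x: "x \<in> V" for x
  proof -
    have "norm (calc \<phi> x) \<le> (\<Sum>\<alpha>\<in>F. cmod (da_coeff \<phi> \<alpha>) * norm (op_pow T \<alpha> x))"
      unfolding calc_apply[OF x] by (rule order.trans[OF norm_sum]) (simp add: norm_scaleC)
    also have "\<dots> \<le> (\<Sum>\<alpha>\<in>F. cmod (da_coeff \<phi> \<alpha>) * (K \<alpha> * norm x))"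
      by (intro sum_mono mult_left_mono K x) auto
    finally show ?thesis by (simp add: sum_distrib_right mult.assoc)
  qed
  then have bd: "\<exists>K. \<forall>x\<in>V. norm (calc \<phi> x) \<le> K * norm x" by blast
  have add: "calc \<phi> (x + y) = calc \<phi> x + calc \<phi> y" if "x \<in> V" "y \<in> V" for x y
    using that by (simp add: calc_apply csubspace_add V T_pow_plus scaleC_add_right sum.distrib)
  have scale: "calc \<phi> (a *\<^sub>C x) = a *\<^sub>C calc \<phi> x" if "x \<in> V" for a x
    using that by (simp add: calc_apply csubspace_scaleC V T_pow_scaleC scaleC_sum_right scaleC_scaleC mult.commute)
  have out: "calc \<phi> x = 0" if "x \<notin> V" for x using that by (simp add: calc_def op_restrict_def)
  show ?thesis unfolding bounded_ops_def mem_Collect_eq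
    using calc_in add scale out bd by blast
qed

lemma calc_poly:
  assumes "finite G" "x \<in> V"
  shows "calc (da_poly G c) x = (\<Sum>\<alpha>\<in>G. c \<alpha> *\<^sub>C op_pow T \<alpha> x)"
proof -
  have "calc (da_poly G c) x = (\<Sum>\<alpha>\<in>F. (if \<alpha> \<in> G then c \<alpha> else 0) *\<^sub>C op_pow T \<alpha> x)"
    by (simp add: calc_apply assms da_coeff_eq[OF da_expansion_poly])
  also have "\<dots> = (\<Sum>\<alpha>\<in>F \<inter> G. c \<alpha> *\<^sub>C op_pow T \<alpha> x)"
    by (subst sum.inter_restrict) (auto intro: sum.cong)
  also have "\<dots> = (\<Sum>\<alpha>\<in>G. c \<alpha> *\<^sub>C op_pow T \<alpha> x)"
  proof (rule sum.mono_neutral_left)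
    show "\<forall>\<alpha>\<in>G - F \<inter> G. c \<alpha> *\<^sub>C op_pow T \<alpha> x = 0"
    proof
      fix \<alpha> assume "\<alpha> \<in> G - F \<inter> G"
      then have "\<alpha> \<notin> F" by blast
      then show "c \<alpha> *\<^sub>C op_pow T \<alpha> x = 0" by (simp add: T_pow_outside assms)
    qed
  qed (use assms in auto)
  finally show ?thesis .
qed

lemma calc_one: "calc (on_ball (\<lambda>z. 1)) = op_restrict V id"
proof
  fix x
  have "on_ball (\<lambda>z :: complex^'d. 1) = da_poly {0} (\<lambda>_. 1)" by (simp add: da_poly_def)
  then show "calc (on_ball (\<lambda>z. 1)) x = op_restrict V id x"
    using calc_poly[of "{0}" x "\<lambda>_. 1"] by (cases "x \<in> V") (auto simp: calc_def op_restrict_def)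
qed

lemma calc_coord: "calc (on_ball (\<lambda>z. z $ k)) = T k"
proof
  fix x
  have "on_ball (\<lambda>z :: complex^'d. z $ k) = da_poly {unit_idx k} (\<lambda>_. 1)" by (simp add: da_poly_def)
  moreover have "op_pow T (unit_idx k) x = T k x" using T_pow_add_unit[of 0 k x] by simp
  ultimately show "calc (on_ball (\<lambda>z. z $ k)) x = T k x"
    using calc_poly[of "{unit_idx k}" x "\<lambda>_. 1"] bounded_opsD(2)[OF T_bounded, of x k]
    by (cases "x \<in> V") (auto simp: calc_def op_restrict_def)
qed

lemma calc_add:
  assumes "\<phi> \<in> drury_arveson" "\<psi> \<in> drury_arveson"
  shows "calc (\<phi> + \<psi>) = calc \<phi> + calc \<psi>"
  using da_coeff_eq[OF da_expansion_add[OF da_expansion_coeff da_expansion_coeff], OF assms]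
  by (simp add: calc_def op_restrict_def fun_eq_iff plus_fun_apply scaleC_add_left sum.distrib)

lemma calc_cmult:
  assumes "\<phi> \<in> drury_arveson"
  shows "calc (\<lambda>z. a * \<phi> z) = (\<lambda>x. a *\<^sub>C calc \<phi> x)"
  using da_coeff_eq[OF da_expansion_cmult[OF da_expansion_coeff[OF assms]], of a]
  by (simp add: calc_def op_restrict_def fun_eq_iff scaleC_sum_right scaleC_scaleC)

lemma calc_mult:
  assumes "\<phi> \<in> drury_arveson" "\<psi> \<in> drury_arveson" "\<phi> * \<psi> \<in> drury_arveson"
  shows "calc (\<phi> * \<psi>) = calc \<phi> \<circ> calc \<psi>"
proof
  fix x
  show "calc (\<phi> * \<psi>) x = (calc \<phi> \<circ> calc \<psi>) x"
  proof (cases "x \<in> V")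
    case x: True
    let ?c = "da_coeff \<phi>" and ?d = "da_coeff \<psi>"
    have "calc (\<phi> * \<psi>) x = (\<Sum>\<gamma>\<in>F. \<Sum>p\<in>{p. fst p + snd p = \<gamma>}.
        (?c (fst p) * ?d (snd p)) *\<^sub>C op_pow T (fst p + snd p) x)"
      unfolding calc_apply[OF x] da_coeff_mult[OF assms]
    proof (rule sum.cong[OF refl])
      fix \<gamma> :: "'d \<Rightarrow> nat"
      have "(\<Sum>i\<in>I. f i) *\<^sub>C u = (\<Sum>i\<in>I. f i *\<^sub>C u)"
        for I :: "(('d \<Rightarrow> nat) \<times> ('d \<Rightarrow> nat)) set" and f and u :: 'a
        by (induction I rule: infinite_finite_induct) (auto simp: scaleC_add_left)
      then show "(\<Sum>p\<in>{p. fst p + snd p = \<gamma>}. ?c (fst p) * ?d (snd p)) *\<^sub>C op_pow T \<gamma> x =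
          (\<Sum>p\<in>{p. fst p + snd p = \<gamma>}. (?c (fst p) * ?d (snd p)) *\<^sub>C op_pow T (fst p + snd p) x)"
        by simp
    qed
    \<comment> \<open>The discarded pairs can be restored, since the power of T at an index outside
      \<open>F\<close> is 0.\<close>
    also have "\<dots> = (\<Sum>\<alpha>\<in>F. \<Sum>\<beta>\<in>F. (?c \<alpha> * ?d \<beta>) *\<^sub>C op_pow T (\<alpha> + \<beta>) x)"
      unfolding sum_splits_F by (intro sum.cong refl) (auto simp: T_pow_outside x)
    also have "\<dots> = (\<Sum>\<alpha>\<in>F. ?c \<alpha> *\<^sub>C op_pow T \<alpha> (calc \<psi> x))"
      by (simp add: calc_apply[OF x] T_pow_sum csubspace_scaleC V T_pow_in x T_pow_scaleC T_pow_add
          scaleC_sum_right scaleC_scaleC)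
    finally show ?thesis by (simp only: o_apply calc_apply[OF calc_in[OF x]])
  next
    case False
    then show ?thesis using bounded_opsD(2)[OF calc_bounded] bounded_ops_0[OF calc_bounded V(1)] by simp
  qed
qed

text \<open>One coordinate of the Poisson kernel: \<open>f\<close> is a coordinate of the Gram
  vectors of the defect form, and the reciprocal weight is the multinomial coefficient of the
  monomial.\<close>

definition coeff_poly :: "('a \<Rightarrow> complex) \<Rightarrow> 'a \<Rightarrow> complex^'d \<Rightarrow> complex" where
  "coeff_poly f u = da_poly F (\<lambda>\<gamma>. f (op_pow A \<gamma> u) / da_weight \<gamma>)"

lemma coeff_poly_in: "coeff_poly f u \<in> drury_arveson"
  unfolding coeff_poly_def by (rule drury_arvesonI[OF da_expansion_poly]) simp

text \<open>With \<open>K u = (\<Sum>s. coeff_poly (f s) u \<otimes> e\<^sub>s)\<close>, the next two lemmas say that \<open>K\<close> is an isometry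
  and that \<open>calc \<phi>\<close> is the compression \<open>K\<^sup>* (M\<^sub>\<phi> \<otimes> I) K\<close>.\<close>

lemma sum_norm_coeff_poly:
  assumes u: "u \<in> V"
    and f: "\<And>\<alpha>. \<alpha> \<in> F \<Longrightarrow> defect (op_pow A \<alpha> u) (op_pow A \<alpha> u) =
      (\<Sum>s<r. f s (op_pow A \<alpha> u) * cnj (f s (op_pow A \<alpha> u)))"
  shows "(\<Sum>s<(r::nat). (ip_norm da_inner (coeff_poly (f s) u))\<^sup>2) = (norm u)\<^sup>2"
proof -
  have "da_weight \<gamma> * (cmod (z / da_weight \<gamma>))\<^sup>2 = (cmod z)\<^sup>2 / da_weight \<gamma>" for z :: complex and \<gamma> :: "'d \<Rightarrow> nat"
    using da_weight_pos[of \<gamma>] by (simp add: norm_divide power2_eq_square)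
  then have *: "(ip_norm da_inner (coeff_poly g u))\<^sup>2 =
      (\<Sum>\<gamma>\<in>F. (cmod (g (op_pow A \<gamma> u)))\<^sup>2 / da_weight \<gamma>)" for g
    unfolding coeff_poly_def da_norm_sq_poly[OF finite_F] by (rule sum.cong[OF refl])
  have "complex_of_real (\<Sum>s<r. (ip_norm da_inner (coeff_poly (f s) u))\<^sup>2) =
      (\<Sum>s<r. \<Sum>\<gamma>\<in>F. f s (op_pow A \<gamma> u) * cnj (f s (op_pow A \<gamma> u)) / da_weight \<gamma>)"
    unfolding * by (simp add: complex_norm_square[symmetric])
  also have "\<dots> = (\<Sum>\<gamma>\<in>F. defect (op_pow A \<gamma> u) (op_pow A \<gamma> u) / da_weight \<gamma>)"
    by (subst sum.swap) (simp add: f sum_divide_distrib)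
  also have "\<dots> = complex_of_real ((norm u)\<^sup>2)"
    by (simp only: sum_defect[OF u u] cinner_self)
  finally show ?thesis by (simp only: of_real_eq_iff)
qed

lemma cinner_calc:
  assumes \<phi>: "\<phi> \<in> da_multipliers" and x: "x \<in> V" and y: "y \<in> V"
    and f: "\<And>\<alpha> \<beta>. \<alpha> \<in> F \<Longrightarrow> \<beta> \<in> F \<Longrightarrow> defect (op_pow A \<alpha> x) (op_pow A \<beta> y) =
      (\<Sum>s<r. f s (op_pow A \<alpha> x) * cnj (f s (op_pow A \<beta> y)))"
  shows "cinner (calc \<phi> x) y =
    (\<Sum>s<(r::nat). da_inner (\<phi> * coeff_poly (f s) x) (coeff_poly (f s) y))"
proof -
  let ?c = "da_coeff \<phi>"
  have w: "complex_of_real (da_weight \<gamma>) \<noteq> 0" for \<gamma> :: "'d \<Rightarrow> nat"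
    using da_weight_pos[of \<gamma>] by simp
  have "da_inner (\<phi> * coeff_poly (f s) x) (coeff_poly (f s) y) =
      (\<Sum>\<beta>\<in>F. \<Sum>\<alpha>\<in>F. if \<beta> + \<alpha> \<in> F then ?c \<beta> / da_weight \<alpha> *
        (f s (op_pow A \<alpha> x) * cnj (f s (op_pow A (\<beta> + \<alpha>) y))) else 0)" for s
  proof -
    \<comment> \<open>The weight of the inner product cancels the reciprocal weight in the second
      polynomial; only the one belonging to \<open>x\<close> survives.\<close>
    have "da_inner (\<phi> * coeff_poly (f s) x) (coeff_poly (f s) y) =
        (\<Sum>\<gamma>\<in>F. da_coeff (\<phi> * coeff_poly (f s) x) \<gamma> * cnj (f s (op_pow A \<gamma> y)))"
      unfolding coeff_poly_def[of _ y] da_inner_poly[OF finite_F] using w by simp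
    also have "\<dots> = (\<Sum>\<gamma>\<in>F. \<Sum>p\<in>{p. fst p + snd p = \<gamma>}. ?c (fst p) *
        da_coeff (coeff_poly (f s) x) (snd p) * cnj (f s (op_pow A (fst p + snd p) y)))"
      using da_coeff_mult[OF multiplier_in_da[OF \<phi>] coeff_poly_in da_multipliersD(2)[OF \<phi> coeff_poly_in], of "f s" x]
      by (simp add: sum_distrib_right)
    also have "\<dots> = (\<Sum>\<beta>\<in>F. \<Sum>\<alpha>\<in>F. if \<beta> + \<alpha> \<in> F then ?c \<beta> / da_weight \<alpha> *
        (f s (op_pow A \<alpha> x) * cnj (f s (op_pow A (\<beta> + \<alpha>) y))) else 0)"
      unfolding sum_splits_F coeff_poly_def
        da_coeff_eq[OF da_expansion_poly[OF finite_F]]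
      by (intro sum.cong refl) auto
    finally show ?thesis .
  qed
  then have "(\<Sum>s<r. da_inner (\<phi> * coeff_poly (f s) x) (coeff_poly (f s) y)) =
      (\<Sum>s<r. \<Sum>\<beta>\<in>F. \<Sum>\<alpha>\<in>F. if \<beta> + \<alpha> \<in> F then ?c \<beta> / da_weight \<alpha> *
        (f s (op_pow A \<alpha> x) * cnj (f s (op_pow A (\<beta> + \<alpha>) y))) else 0)" by simp
  also have "\<dots> = (\<Sum>\<beta>\<in>F. \<Sum>s<r. \<Sum>\<alpha>\<in>F. if \<beta> + \<alpha> \<in> F then ?c \<beta> / da_weight \<alpha> *
        (f s (op_pow A \<alpha> x) * cnj (f s (op_pow A (\<beta> + \<alpha>) y))) else 0)"
    by (rule sum.swap)
  also have "\<dots> = (\<Sum>\<beta>\<in>F. \<Sum>\<alpha>\<in>F. \<Sum>s<r. if \<beta> + \<alpha> \<in> F then ?c \<beta> / da_weight \<alpha> *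
        (f s (op_pow A \<alpha> x) * cnj (f s (op_pow A (\<beta> + \<alpha>) y))) else 0)"
    by (rule sum.cong[OF refl], rule sum.swap)
  \<comment> \<open>Summing over \<open>s\<close> restores the defect form. For a sum of indices
    outside \<open>F\<close> both sides are 0, as the adjoint power of \<open>y\<close>
    vanishes.\<close>
  also have "\<dots> = (\<Sum>\<beta>\<in>F. \<Sum>\<alpha>\<in>F. ?c \<beta> * (defect (op_pow A \<alpha> x) (op_pow A \<alpha> (op_pow A \<beta> y)) / da_weight \<alpha>))"
  proof (intro sum.cong refl)
    fix \<alpha> \<beta> :: "'d \<Rightarrow> nat" assume \<alpha>: "\<alpha> \<in> F"
    have "op_pow A \<alpha> (op_pow A \<beta> y) = op_pow A (\<beta> + \<alpha>) y"
      using A_pow_add[of \<alpha> \<beta> y] by (simp add: add.commute)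
    then show "(\<Sum>s<r. if \<beta> + \<alpha> \<in> F then ?c \<beta> / da_weight \<alpha> *
          (f s (op_pow A \<alpha> x) * cnj (f s (op_pow A (\<beta> + \<alpha>) y))) else 0) =
        ?c \<beta> * (defect (op_pow A \<alpha> x) (op_pow A \<alpha> (op_pow A \<beta> y)) / da_weight \<alpha>)"
      using f[OF \<alpha>, of "\<beta> + \<alpha>"]
      by (cases "\<beta> + \<alpha> \<in> F") (auto simp: sum_distrib_left A_pow_outside y defect_zero_right
          sum_divide_distrib intro!: sum.cong)
  qed
  \<comment> \<open>The telescoped identity is applied to \<open>x\<close> and the adjoint power of
    \<open>y\<close>.\<close>
  also have "\<dots> = (\<Sum>\<beta>\<in>F. ?c \<beta> * cinner x (op_pow A \<beta> y))"
    by (simp only: sum_distrib_left[symmetric] sum_defect x y A_pow_in)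
  also have "\<dots> = cinner (calc \<phi> x) y"
    by (simp add: calc_apply x cinner_sum_left cinner_scaleC_left cinner_A_pow y)
  finally show ?thesis by simp
qed

end

section \<open>Complete contractivity and weak-* continuity\<close>

text \<open>Finite Cauchy--Schwarz after splitting each weight into two square roots.\<close>

lemma da_inner_poly_bound:
  assumes f: "f \<in> drury_arveson" and G: "finite G"
  shows "cmod (da_inner f (da_poly G c)) \<le> ip_norm da_inner f * ip_norm da_inner (da_poly G c)"
proof -
  let ?a = "\<lambda>\<alpha>. sqrt (da_weight \<alpha>) * cmod (da_coeff f \<alpha>)" and ?b = "\<lambda>\<alpha>. sqrt (da_weight \<alpha>) * cmod (c \<alpha>)"
  have "cmod (da_inner f (da_poly G c)) \<le> (\<Sum>\<alpha>\<in>G. \<bar>?a \<alpha>\<bar> * \<bar>?b \<alpha>\<bar>)"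
    unfolding da_inner_poly[OF G]
  proof (rule order.trans[OF norm_sum], rule sum_mono)
    fix \<alpha>
    have e: "\<bar>?a \<alpha>\<bar> * \<bar>?b \<alpha>\<bar> = (sqrt (da_weight \<alpha>) * sqrt (da_weight \<alpha>)) * cmod (da_coeff f \<alpha>) * cmod (c \<alpha>)"
      by (simp only: abs_mult abs_norm_cancel real_sqrt_abs2 mult_ac) simp
    show "cmod (complex_of_real (da_weight \<alpha>) * da_coeff f \<alpha> * cnj (c \<alpha>)) \<le> \<bar>?a \<alpha>\<bar> * \<bar>?b \<alpha>\<bar>"
      unfolding e by (simp add: norm_mult)
  qed
  also have "\<dots> \<le> L2_set ?a G * L2_set ?b G" by (rule L2_set_mult_ineq)
  also have "\<dots> \<le> ip_norm da_inner f * ip_norm da_inner (da_poly G c)"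
  proof (rule mult_mono)
    show "L2_set ?a G \<le> ip_norm da_inner f"
      using finite_sum_le_da_norm_sq[OF f G] ip_norm_da_nonneg[OF f]
      by (simp add: L2_set_def power_mult_distrib real_le_lsqrt)
    have p: "da_poly G c \<in> drury_arveson" by (rule drury_arvesonI[OF da_expansion_poly[OF G]])
    then show "L2_set ?b G \<le> ip_norm da_inner (da_poly G c)"
      using ip_norm_da_nonneg[OF p]
      by (simp add: L2_set_def power_mult_distrib real_le_lsqrt da_norm_sq_poly[OF G])
  qed (use f in \<open>auto simp: L2_set_nonneg\<close>)
  finally show ?thesis .
qed

lemma da_inner_sum_poly:
  assumes "\<And>j. j \<in> J \<Longrightarrow> h j \<in> drury_arveson" and G: "finite G"
  shows "da_inner (\<Sum>j\<in>J. h j) (da_poly G c) = (\<Sum>j\<in>J. da_inner (h j) (da_poly G c))"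
proof -
  have "da_coeff (\<Sum>j\<in>J. h j) = (\<lambda>\<alpha>. \<Sum>j\<in>J. da_coeff (h j) \<alpha>)"
    by (rule da_coeff_eq, rule da_expansion_sum, rule da_expansion_coeff, rule assms)
  then show ?thesis
    unfolding da_inner_poly[OF G] by (subst sum.swap) (simp add: sum_distrib_left sum_distrib_right)
qed

lemma da_sum_in: "(\<And>j. j \<in> J \<Longrightarrow> h j \<in> drury_arveson) \<Longrightarrow> (\<Sum>j\<in>J. h j) \<in> drury_arveson"
  by (rule drury_arvesonI, rule da_expansion_sum, rule da_expansion_coeff)

lemma ip_norm_da_one: "ip_norm da_inner (on_ball (\<lambda>z :: complex^'d::finite. 1)) = 1"
proof -
  have "on_ball (\<lambda>z :: complex^'d. 1) = da_poly {0} (\<lambda>_. 1)" by (simp add: da_poly_def)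
  then have "(ip_norm da_inner (on_ball (\<lambda>z :: complex^'d. 1)))\<^sup>2 = 1"
    using da_norm_sq_poly[of "{0 :: 'd \<Rightarrow> nat}" "\<lambda>_. 1"]
    by (simp add: da_weight_def zero_fun_apply)
  then show ?thesis using ip_norm_da_nonneg[OF da_one[where 'a = 'd]] by (auto simp: power2_eq_1_iff)
qed

text \<open>Test the bound on the tuple of constant functions 1, whose norm is the square root of n.
  The sign of \<open>C\<close> is needed when estimates are multiplied by it.\<close>

lemma op_matrix_norm_le_da_nonneg:
  assumes "op_matrix_norm_le (drury_arveson :: (complex^'d::finite \<Rightarrow> complex) set) da_inner n A C" and "n > 0"
  shows "0 \<le> C"
proof -
  let ?v = "\<lambda>j::nat. on_ball (\<lambda>z :: complex^'d. 1)"
  have "0 \<le> L2_set (\<lambda>i. ip_norm da_inner (\<Sum>j<n. A i j (?v j))) {..<n}" by (rule L2_set_nonneg)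
  also have "\<dots> \<le> C * L2_set (\<lambda>j. ip_norm da_inner (?v j)) {..<n}"
    using assms(1)[unfolded op_matrix_norm_le_def, rule_format, of ?v] da_one by blast
  also have "\<dots> = C * sqrt (real n)" by (simp add: ip_norm_da_one L2_set_def)
  finally show ?thesis using assms(2) by (simp add: zero_le_mult_iff)
qed

section \<open>Weak-* topologies through their subbasic sets\<close>

lemma openin_weak_star:
  assumes "\<And>n. f n \<in> V" "\<And>n. g n \<in> V" "summable (\<lambda>n. (ip_norm ip (f n))\<^sup>2)"
    "summable (\<lambda>n. (ip_norm ip (g n))\<^sup>2)" "open U"
  shows "openin (weak_star V ip I A) {i \<in> I. (\<Sum>n. ip (A i (f n)) (g n)) \<in> U}"
  unfolding weak_star_def by (rule topology_generated_by_Basis) (use assms in blast)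

text \<open>The carrier of a generated topology is the union of its generators. The constant
  sequence at a null vector is square-summable, and with \<open>U = UNIV\<close> it yields the
  generator \<open>I\<close>.\<close>

lemma topspace_weak_star:
  assumes "u \<in> V" "ip u u = 0" "\<And>i. ip (A i u) u = 0"
  shows "topspace (weak_star V ip I A) = I"
proof
  show "topspace (weak_star V ip I A) \<subseteq> I"
    unfolding weak_star_def topology_generated_by_topspace by auto
  have "openin (weak_star V ip I A) {i \<in> I. (\<Sum>n::nat. ip (A i u) u) \<in> UNIV}"
    by (rule openin_weak_star) (use assms in \<open>simp_all add: ip_norm_def\<close>)
  then show "I \<subseteq> topspace (weak_star V ip I A)" using openin_subset by force
qed

lemma continuous_map_weak_star:
  assumes "u \<in> V" "ip u u = 0" and h: "h ` topspace X \<subseteq> I"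
    and op: "\<And>f g U. \<lbrakk>\<And>n::nat. f n \<in> V; \<And>n. g n \<in> V; summable (\<lambda>n. (ip_norm ip (f n))\<^sup>2);
      summable (\<lambda>n. (ip_norm ip (g n))\<^sup>2); open U\<rbrakk> \<Longrightarrow>
      openin X {x \<in> topspace X. (\<Sum>n. ip (A (h x) (f n)) (g n)) \<in> U}"
  shows "continuous_map X (weak_star V ip I A) h"
  unfolding weak_star_def
proof (rule continuous_on_generated_topo, goal_cases)
  case (1 W)
  then obtain f g U where W: "W = {i \<in> I. (\<Sum>n. ip (A i (f n)) (g n)) \<in> U}"
    and fg: "\<And>n::nat. f n \<in> V" "\<And>n. g n \<in> V" "summable (\<lambda>n. (ip_norm ip (f n))\<^sup>2)"
      "summable (\<lambda>n. (ip_norm ip (g n))\<^sup>2)" "open U" by blast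
  have "h -` W \<inter> topspace X = {x \<in> topspace X. (\<Sum>n. ip (A (h x) (f n)) (g n)) \<in> U}"
    using h by (auto simp: W)
  then show ?case using op[OF fg] by simp
next
  case 2
  have "I \<in> {{i \<in> I. (\<Sum>n. ip (A i (f n)) (g n)) \<in> U} | f g U.
        (\<forall>n::nat. f n \<in> V \<and> g n \<in> V) \<and> summable (\<lambda>n. (ip_norm ip (f n))\<^sup>2) \<and>
        summable (\<lambda>n. (ip_norm ip (g n))\<^sup>2) \<and> open U}"
    using assms(1,2)
    by (intro CollectI exI[of _ "\<lambda>_. u"] exI[of _ UNIV]) (simp add: ip_norm_def)
  then show ?case using h by blast
qed

context nilpotent_row
begin

text \<open>A compression of M tensor I along an isometry has at most the norm of M. Concretely, the
  output \<open>y\<close> is tested against itself, carried into the Drury--Arveson space, and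
  bounded by Cauchy--Schwarz.\<close>

lemma calc_contractive:
  assumes \<phi>: "\<forall>i<n. \<forall>j<n. \<phi> i j \<in> da_multipliers"
    and C: "op_matrix_norm_le drury_arveson da_inner n (\<lambda>i j f. \<phi> i j * f) C"
  shows "op_matrix_norm_le V cinner n (\<lambda>i j. calc (\<phi> i j)) C"
  unfolding op_matrix_norm_le_def ip_norm_cinner
proof (intro allI impI)
  fix v :: "nat \<Rightarrow> 'a" assume v: "\<forall>j<n. v j \<in> V"
  define y where "y i = (\<Sum>j<n. calc (\<phi> i j) (v j))" for i
  have y: "y i \<in> V" for i
    unfolding y_def by (rule csubspace_sum[OF V(1)]) (use v in \<open>auto intro: calc_in\<close>)
  \<comment> \<open>Only the adjoint powers of the inputs and outputs occur, so the factorization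
    may be chosen after the vectors; one factorization must serve all of them at once.\<close>
  define X where "X = (\<lambda>(\<alpha>, j). op_pow A \<alpha> (v j)) ` (F \<times> {..<n}) \<union> (\<lambda>(\<alpha>, j). op_pow A \<alpha> (y j)) ` (F \<times> {..<n})"
  have "finite X" "X \<subseteq> V" using v y by (auto simp: X_def A_pow_in)
  from gram_factorization[OF V(1) this psd_defect] obtain r :: nat and f
    where f: "\<forall>a\<in>X. \<forall>b\<in>X. defect a b = (\<Sum>s<r. f s a * cnj (f s b))" by blast
  have Xv: "op_pow A \<alpha> (v j) \<in> X" if "\<alpha> \<in> F" "j < n" for \<alpha> j
    using that unfolding X_def by force
  have Xy: "op_pow A \<alpha> (y j) \<in> X" if "\<alpha> \<in> F" "j < n" for \<alpha> j
    using that unfolding X_def by force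
  define g where "g s u = coeff_poly (f s) u" for s u
  define a where "a s = L2_set (\<lambda>j. ip_norm da_inner (g s (v j))) {..<n}" for s
  define b where "b s = L2_set (\<lambda>i. ip_norm da_inner (g s (y i))) {..<n}" for s
  define h where "h s i = (\<Sum>j<n. \<phi> i j * g s (v j))" for s i
  have hj: "\<phi> i j * g s (v j) \<in> drury_arveson" if "i < n" "j < n" for i j s
    unfolding g_def by (rule da_multipliersD(2)) (use \<phi> that coeff_poly_in in auto)
  \<comment> \<open>The isometry property, with the sums over coordinates and entries
    exchanged.\<close>
  have sq: "L2_set (\<lambda>s. L2_set (\<lambda>j. ip_norm da_inner (g s (u j))) {..<n}) {..<r} = L2_set (\<lambda>j. norm (u j)) {..<n}"
    if u: "\<And>j. j < n \<Longrightarrow> u j \<in> V" "\<And>\<alpha> j. \<alpha> \<in> F \<Longrightarrow> j < n \<Longrightarrow> op_pow A \<alpha> (u j) \<in> X" for u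
  proof -
    have "(\<Sum>s<r. (ip_norm da_inner (g s (u j)))\<^sup>2) = (norm (u j))\<^sup>2" if "j < n" for j
      unfolding g_def using f u that by (intro sum_norm_coeff_poly) auto
    then show ?thesis
      unfolding L2_set_def
      by (simp add: sum_nonneg) (subst sum.swap, simp)
  qed
  have "complex_of_real (\<Sum>i<n. (norm (y i))\<^sup>2) = (\<Sum>i<n. \<Sum>j<n. cinner (calc (\<phi> i j) (v j)) (y i))"
  proof -
    have "complex_of_real ((norm (y i))\<^sup>2) = (\<Sum>j<n. cinner (calc (\<phi> i j) (v j)) (y i))" for i
      unfolding cinner_self[symmetric] by (simp add: y_def[of i] cinner_sum_left)
    then show ?thesis by (simp only: of_real_sum)
  qed
  also have "\<dots> = (\<Sum>i<n. \<Sum>j<n. \<Sum>s<r. da_inner (\<phi> i j * g s (v j)) (g s (y i)))"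
    unfolding g_def using \<phi> v y f Xv Xy by (intro sum.cong refl cinner_calc) auto
  also have "\<dots> = (\<Sum>i<n. \<Sum>s<r. da_inner (h s i) (g s (y i)))"
  proof (rule sum.cong[OF refl])
    fix i assume "i \<in> {..<n}"
    then have "(\<Sum>j<n. da_inner (\<phi> i j * g s (v j)) (g s (y i))) = da_inner (h s i) (g s (y i))" for s
      unfolding h_def g_def coeff_poly_def[of _ "y i"] using hj[unfolded g_def]
      by (intro da_inner_sum_poly[symmetric]) auto
    then show "(\<Sum>j<n. \<Sum>s<r. da_inner (\<phi> i j * g s (v j)) (g s (y i))) =
        (\<Sum>s<r. da_inner (h s i) (g s (y i)))" by (subst sum.swap) simp
  qed
  finally have e: "complex_of_real (\<Sum>i<n. (norm (y i))\<^sup>2) = (\<Sum>i<n. \<Sum>s<r. da_inner (h s i) (g s (y i)))" .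
  have "(\<Sum>i<n. (norm (y i))\<^sup>2) = cmod (complex_of_real (\<Sum>i<n. (norm (y i))\<^sup>2))"
    by (simp only: norm_of_real abs_of_nonneg sum_nonneg zero_le_power2)
  also have "\<dots> = cmod (\<Sum>i<n. \<Sum>s<r. da_inner (h s i) (g s (y i)))" by (simp only: e)
  also have "\<dots> = cmod (\<Sum>s<r. \<Sum>i<n. da_inner (h s i) (g s (y i)))" by (subst sum.swap) simp
  also have "\<dots> \<le> (\<Sum>s<r. \<Sum>i<n. \<bar>ip_norm da_inner (h s i)\<bar> * \<bar>ip_norm da_inner (g s (y i))\<bar>)"
  proof (rule order.trans[OF norm_sum], rule sum_mono, rule order.trans[OF norm_sum], rule sum_mono)
    fix s i assume "i \<in> {..<n}"
    then have "h s i \<in> drury_arveson" unfolding h_def using hj by (intro da_sum_in) auto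
    then have "cmod (da_inner (h s i) (g s (y i))) \<le> ip_norm da_inner (h s i) * ip_norm da_inner (g s (y i))"
      unfolding g_def coeff_poly_def by (rule da_inner_poly_bound) simp
    also have "\<dots> \<le> \<bar>ip_norm da_inner (h s i)\<bar> * \<bar>ip_norm da_inner (g s (y i))\<bar>"
      unfolding abs_mult[symmetric] by (rule abs_ge_self)
    finally show "cmod (da_inner (h s i) (g s (y i))) \<le>
      \<bar>ip_norm da_inner (h s i)\<bar> * \<bar>ip_norm da_inner (g s (y i))\<bar>" .
  qed
  \<comment> \<open>M tensor I acts separately in each coordinate \<open>s\<close>, so the assumed
    bound applies to the tuple \<open>g s (v j)\<close> for each \<open>s\<close>.\<close>
  also have "\<dots> \<le> (\<Sum>s<r. C * a s * b s)"
  proof (rule sum_mono)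
    fix s
    have "(\<Sum>i<n. \<bar>ip_norm da_inner (h s i)\<bar> * \<bar>ip_norm da_inner (g s (y i))\<bar>) \<le>
        L2_set (\<lambda>i. ip_norm da_inner (h s i)) {..<n} * b s"
      unfolding b_def by (rule L2_set_mult_ineq)
    also have "\<dots> \<le> (C * a s) * b s"
    proof (rule mult_right_mono)
      show "L2_set (\<lambda>i. ip_norm da_inner (h s i)) {..<n} \<le> C * a s"
        using C[unfolded op_matrix_norm_le_def, rule_format, of "\<lambda>j. g s (v j)"]
        by (simp add: h_def a_def g_def coeff_poly_in)
    qed (simp add: b_def L2_set_nonneg)
    finally show "(\<Sum>i<n. \<bar>ip_norm da_inner (h s i)\<bar> * \<bar>ip_norm da_inner (g s (y i))\<bar>) \<le> C * a s * b s" .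
  qed
  finally have main: "(\<Sum>i<n. (norm (y i))\<^sup>2) \<le> (\<Sum>s<r. C * a s * b s)" .
  let ?Y = "L2_set (\<lambda>i. norm (y i)) {..<n}" and ?v = "L2_set (\<lambda>j. norm (v j)) {..<n}"
  have "?Y \<le> C * ?v"
  proof (cases "n = 0")
    case False
    then have C0: "0 \<le> C" using op_matrix_norm_le_da_nonneg[OF C] by simp
    have "?Y * ?Y = (\<Sum>i<n. (norm (y i))\<^sup>2)"
      by (simp add: L2_set_def sum_nonneg)
    also have "\<dots> \<le> C * (\<Sum>s<r. \<bar>a s\<bar> * \<bar>b s\<bar>)"
      using main by (simp add: sum_distrib_left mult.assoc a_def b_def L2_set_nonneg)
    also have "\<dots> \<le> C * (L2_set a {..<r} * L2_set b {..<r})"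
      by (intro mult_left_mono L2_set_mult_ineq C0)
    also have "\<dots> = (C * ?v) * ?Y"
      using sq[of v] sq[of y] v y Xv Xy by (simp add: a_def[abs_def] b_def[abs_def])
    finally have "?Y * ?Y \<le> (C * ?v) * ?Y" .
    then show ?thesis
      using C0 L2_set_nonneg[of "\<lambda>i. norm (y i)" "{..<n}"] L2_set_nonneg[of "\<lambda>i. norm (v i)" "{..<n}"]
      by (cases "?Y = 0") (auto simp: mult_le_cancel_right)
  qed simp
  then show "L2_set (\<lambda>i. norm (\<Sum>j<n. calc (\<phi> i j) (v j))) {..<n} \<le> C * ?v"
    by (simp add: y_def)
qed

text \<open>A weak-* functional of \<open>calc \<phi>\<close> sees only finitely many coefficients
  of \<open>\<phi>\<close>. It is therefore the pairing of \<open>\<phi>\<close> times 1 with a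
  fixed polynomial, itself a weak-* functional, and preimages of subbasic sets are subbasic.\<close>

lemma calc_weak_star_continuous:
  "continuous_map (weak_star drury_arveson da_inner da_multipliers (\<lambda>\<phi> f. \<phi> * f))
     (weak_star V cinner (bounded_ops V) (\<lambda>A. A)) calc"
proof -
  let ?W = "weak_star drury_arveson da_inner da_multipliers (\<lambda>(\<phi> :: complex^'d \<Rightarrow> complex) f. \<phi> * f)"
  have da0: "(0 :: complex^'d \<Rightarrow> complex) \<in> drury_arveson" by (rule drury_arvesonI[OF da_expansion_zero])
  have ip00: "da_inner f (0 :: complex^'d \<Rightarrow> complex) = 0" for f
    by (simp add: da_inner_def da_coeff_eq[OF da_expansion_zero])
  have top: "topspace ?W = da_multipliers"
    by (rule topspace_weak_star[where u = 0]) (simp_all only: da0 ip00)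
  show ?thesis
  proof (rule continuous_map_weak_star)
    show "(0::'a) \<in> V" by (rule csubspace_0[OF V(1)])
    show "calc ` topspace ?W \<subseteq> bounded_ops V" using calc_bounded by blast
  next
    fix f g :: "nat \<Rightarrow> 'a" and U :: "complex set"
    assume fV: "\<And>n. f n \<in> V" and gV: "\<And>n. g n \<in> V"
      and sf: "summable (\<lambda>n. (ip_norm cinner (f n))\<^sup>2)"
      and sg: "summable (\<lambda>n. (ip_norm cinner (g n))\<^sup>2)" and U: "open U"
    note sf = sf[unfolded ip_norm_cinner] and sg = sg[unfolded ip_norm_cinner]
    have sm: "summable (\<lambda>n. cinner (op_pow T \<alpha> (f n)) (g n))" for \<alpha>
    proof -
      obtain K where K: "\<forall>x\<in>V. norm (op_pow T \<alpha> x) \<le> K * norm x" using T_pow_bound by blast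
      have "summable (\<lambda>n. \<bar>K\<bar> * ((norm (f n))\<^sup>2 + (norm (g n))\<^sup>2))"
        by (intro summable_mult summable_add sf sg)
      moreover have "norm (cinner (op_pow T \<alpha> (f n)) (g n)) \<le> \<bar>K\<bar> * ((norm (f n))\<^sup>2 + (norm (g n))\<^sup>2)" for n
      proof -
        have "norm (op_pow T \<alpha> (f n)) \<le> \<bar>K\<bar> * norm (f n)"
          by (rule order.trans[OF bspec[OF K fV[of n]] mult_right_mono]) auto
        then have "norm (op_pow T \<alpha> (f n)) * norm (g n) \<le> (\<bar>K\<bar> * norm (f n)) * norm (g n)"
          by (intro mult_right_mono) auto
        with cauchy_schwarz[of "op_pow T \<alpha> (f n)" "g n"]
        have "norm (cinner (op_pow T \<alpha> (f n)) (g n)) \<le> \<bar>K\<bar> * (norm (f n) * norm (g n))"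
          by (simp add: mult.assoc)
        also have "\<dots> \<le> \<bar>K\<bar> * ((norm (f n))\<^sup>2 + (norm (g n))\<^sup>2)"
        proof (rule mult_left_mono)
          have "0 \<le> norm (f n) * norm (g n)" by simp
          then show "norm (f n) * norm (g n) \<le> (norm (f n))\<^sup>2 + (norm (g n))\<^sup>2"
            using sum_squares_bound[of "norm (f n)" "norm (g n)"] by linarith
        qed simp
        finally show ?thesis .
      qed
      ultimately show ?thesis by (rule summable_comparison_test'[where N = 0])
    qed
    define \<tau> where "\<tau> \<alpha> = (\<Sum>n. cinner (op_pow T \<alpha> (f n)) (g n))" for \<alpha>
    \<comment> \<open>Conjugation and reciprocal weight undo those of the inner product, so that
      pairing with \<open>H\<close> gives the sum of coefficients times
      \<open>\<tau>\<close>.\<close>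
    define H where "H = da_poly F (\<lambda>\<alpha>. cnj (\<tau> \<alpha>) / da_weight \<alpha>)"
    have w: "da_weight \<gamma> \<noteq> 0" for \<gamma> :: "'d \<Rightarrow> nat"
      using da_weight_pos[of \<gamma>] by simp
    \<comment> \<open>The representing functional has rank one; the definition asks for sequences,
      so they are concentrated at index 0.\<close>
    define f' :: "nat \<Rightarrow> complex^'d \<Rightarrow> complex" where "f' n = (if n = 0 then on_ball (\<lambda>z. 1) else 0)" for n
    define g' :: "nat \<Rightarrow> complex^'d \<Rightarrow> complex" where "g' n = (if n = 0 then H else 0)" for n
    have eq: "(\<Sum>n. cinner (calc \<phi> (f n)) (g n)) = (\<Sum>n. da_inner (\<phi> * f' n) (g' n))"
      if \<phi>: "\<phi> \<in> da_multipliers" for \<phi>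
    proof -
      have "(\<Sum>n. cinner (calc \<phi> (f n)) (g n)) =
          (\<Sum>n. \<Sum>\<alpha>\<in>F. da_coeff \<phi> \<alpha> * cinner (op_pow T \<alpha> (f n)) (g n))"
        by (simp add: calc_apply fV cinner_sum_left cinner_scaleC_left)
      also have "\<dots> = (\<Sum>\<alpha>\<in>F. da_coeff \<phi> \<alpha> * \<tau> \<alpha>)"
        unfolding \<tau>_def suminf_mult[OF sm, symmetric] by (rule suminf_sum) (rule summable_mult[OF sm])
      also have "\<dots> = da_inner \<phi> H"
        unfolding H_def da_inner_poly[OF finite_F]
        by (rule sum.cong[OF refl]) (simp add: w)
      also have "\<dots> = da_inner (\<phi> * on_ball (\<lambda>z. 1)) H"
        by (subst mult_on_ball_one) (use da_multipliersD(1)[OF \<phi>] in blast)+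
      also have "\<dots> = (\<Sum>n\<in>{0}. da_inner (\<phi> * f' n) (g' n))"
        by (simp add: f'_def g'_def)
      also have "\<dots> = (\<Sum>n. da_inner (\<phi> * f' n) (g' n))"
        by (rule suminf_finite[symmetric]) (auto simp: g'_def ip00)
      finally show ?thesis .
    qed
    have "{\<phi> \<in> topspace ?W. (\<Sum>n. cinner (calc \<phi> (f n)) (g n)) \<in> U} =
        {\<phi> \<in> da_multipliers. (\<Sum>n. da_inner (\<phi> * f' n) (g' n)) \<in> U}"
      unfolding top by (rule Collect_cong, rule conj_cong[OF refl], simp only: eq)
    moreover have "openin ?W {\<phi> \<in> da_multipliers. (\<Sum>n. da_inner (\<phi> * f' n) (g' n)) \<in> U}"
    proof (rule openin_weak_star[OF _ _ _ _ U])
      show "f' n \<in> drury_arveson" "g' n \<in> drury_arveson" for n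
        using da_one da0 drury_arvesonI[OF da_expansion_poly[OF finite_F]] by (auto simp: f'_def g'_def H_def)
      show "summable (\<lambda>n. (ip_norm da_inner (f' n))\<^sup>2)" "summable (\<lambda>n. (ip_norm da_inner (g' n))\<^sup>2)"
        by (rule summable_finite[of "{0}"]; simp add: f'_def g'_def ip_norm_def ip00)+
    qed
    ultimately show "openin ?W {\<phi> \<in> topspace ?W. (\<Sum>n. cinner (calc \<phi> (f n)) (g n)) \<in> U}"
      by (simp only:)
  qed simp_all
qed

section \<open>Existence of a functional calculus, and the values of any such calculus at
  polynomials\<close>

lemma functional_calculus_calc: "functional_calculus V T calc"
  unfolding functional_calculus_def
proof (intro conjI)
  show "\<forall>\<phi>\<in>da_multipliers. calc \<phi> \<in> bounded_ops V"
    using calc_bounded by blast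
  show "\<forall>\<phi>\<in>da_multipliers. \<forall>\<psi>\<in>da_multipliers. calc (\<phi> + \<psi>) = calc \<phi> + calc \<psi>"
    using calc_add multiplier_in_da by blast
  show "\<forall>a. \<forall>\<phi>\<in>da_multipliers. calc (\<lambda>z. a * \<phi> z) = (\<lambda>x. a *\<^sub>C calc \<phi> x)"
    using calc_cmult multiplier_in_da by blast
  show "\<forall>\<phi>\<in>da_multipliers. \<forall>\<psi>\<in>da_multipliers. calc (\<phi> * \<psi>) = calc \<phi> \<circ> calc \<psi>"
    using calc_mult multiplier_in_da da_multipliers_mult by blast
  show "calc (on_ball (\<lambda>z. 1)) = op_restrict V id" by (rule calc_one)
  show "\<forall>k. calc (on_ball (\<lambda>z. z $ k)) = T k" using calc_coord by blast
  show "\<forall>n \<phi> C. (\<forall>i<n. \<forall>j<n. \<phi> i j \<in> da_multipliers) \<longrightarrow>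
        op_matrix_norm_le drury_arveson da_inner n (\<lambda>i j f. \<phi> i j * f) C \<longrightarrow>
        op_matrix_norm_le V cinner n (\<lambda>i j. calc (\<phi> i j)) C"
    using calc_contractive by blast
qed (rule calc_weak_star_continuous)

lemma functional_calculus_calculus: "functional_calculus V T (calculus V T)"
  unfolding calculus_def by (rule someI[of "functional_calculus V T", OF functional_calculus_calc])

text \<open>Stated for an arbitrary calculus because \<open>SOME\<close> need not return
  \<open>calc\<close>: multiplicativity and the values at 1 and the coordinates determine the
  monomials.\<close>

lemma functional_calculus_mpow:
  assumes "functional_calculus V T \<Phi>"
  shows "on_ball (mpow \<alpha>) \<in> da_multipliers \<and> (\<forall>x\<in>V. \<Phi> (on_ball (mpow \<alpha>)) x = op_pow T \<alpha> x)"
proof (induction \<alpha> rule: midx_induct)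
  case zero
  have m0: "mpow (0 :: 'd \<Rightarrow> nat) = (\<lambda>z. 1)" by (simp add: fun_eq_iff)
  have "\<Phi> (on_ball (\<lambda>z. 1)) = op_restrict V id" using assms by (simp add: functional_calculus_def)
  then show ?case unfolding m0 by (simp add: da_multipliers_one op_restrict_def)
next
  case (add_unit \<alpha> k)
  have e: "on_ball (mpow (\<alpha> + unit_idx k)) = on_ball (\<lambda>z. z $ k) * on_ball (mpow \<alpha>)"
    by (auto simp: on_ball_def fun_eq_iff mpow_add)
  have "\<Phi> (on_ball (\<lambda>z. z $ k) * on_ball (mpow \<alpha>)) = T k \<circ> \<Phi> (on_ball (mpow \<alpha>))"
    using assms add_unit da_multipliers_coord unfolding functional_calculus_def by metis
  then have "\<Phi> (on_ball (\<lambda>z. z $ k) * on_ball (mpow \<alpha>)) x = op_pow T (\<alpha> + unit_idx k) x" if "x \<in> V" for x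
    using add_unit that by (simp only: o_apply T_pow_add_unit)
  moreover have "on_ball (\<lambda>z. z $ k) * on_ball (mpow \<alpha>) \<in> da_multipliers"
    by (rule da_multipliers_mult[OF da_multipliers_coord]) (use add_unit in blast)
  ultimately show ?case unfolding e by blast
qed

lemma functional_calculus_poly:
  assumes \<Phi>: "functional_calculus V T \<Phi>" and "finite G"
  shows "da_poly G c \<in> da_multipliers \<and> (\<forall>x\<in>V. \<Phi> (da_poly G c) x = (\<Sum>\<alpha>\<in>G. c \<alpha> *\<^sub>C op_pow T \<alpha> x))"
  using assms(2)
proof (induction G rule: finite_induct)
  case empty
  have "da_poly {} c = (\<lambda>z. 0 * on_ball (\<lambda>z. 1) z)" by (simp add: da_poly_def on_ball_def fun_eq_iff)
  moreover have "\<Phi> (\<lambda>z. 0 * on_ball (\<lambda>z. 1) z) = (\<lambda>x. 0 *\<^sub>C \<Phi> (on_ball (\<lambda>z. 1)) x)"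
    using \<Phi> da_multipliers_one unfolding functional_calculus_def by blast
  ultimately show ?case using da_multipliers_cmult[OF da_multipliers_one, of 0] by simp
next
  case (insert \<alpha> G)
  note m = functional_calculus_mpow[OF \<Phi>, of \<alpha>]
  have e: "da_poly (insert \<alpha> G) c = (\<lambda>z. c \<alpha> * on_ball (mpow \<alpha>) z) + da_poly G c"
    using insert.hyps by (auto simp: da_poly_def on_ball_def fun_eq_iff plus_fun_apply)
  have cm: "(\<lambda>z. c \<alpha> * on_ball (mpow \<alpha>) z) \<in> da_multipliers" by (rule da_multipliers_cmult) (use m in blast)
  have "\<Phi> ((\<lambda>z. c \<alpha> * on_ball (mpow \<alpha>) z) + da_poly G c) =
      \<Phi> (\<lambda>z. c \<alpha> * on_ball (mpow \<alpha>) z) + \<Phi> (da_poly G c)"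
    using \<Phi> cm insert.IH unfolding functional_calculus_def by blast
  moreover have "\<Phi> (\<lambda>z. c \<alpha> * on_ball (mpow \<alpha>) z) = (\<lambda>x. c \<alpha> *\<^sub>C \<Phi> (on_ball (mpow \<alpha>)) x)"
    using \<Phi> m unfolding functional_calculus_def by blast
  ultimately have "\<Phi> ((\<lambda>z. c \<alpha> * on_ball (mpow \<alpha>) z) + da_poly G c) x =
      (\<Sum>\<alpha>\<in>insert \<alpha> G. c \<alpha> *\<^sub>C op_pow T \<alpha> x)" if "x \<in> V" for x
    using insert m that by (simp only: plus_fun_apply sum.insert[OF insert.hyps])
  moreover have "(\<lambda>z. c \<alpha> * on_ball (mpow \<alpha>) z) + da_poly G c \<in> da_multipliers"
    by (rule da_multipliers_add[OF cm]) (use insert.IH in blast)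
  ultimately show ?case unfolding e by blast
qed

text \<open>The bridge from the annihilator hypothesis to plain operator identities, usable for both
  T and its restriction.\<close>

lemma da_poly_Ann_c_iff:
  assumes "finite G"
  shows "da_poly G c \<in> Ann_c V T \<longleftrightarrow> (\<forall>x\<in>V. (\<Sum>\<alpha>\<in>G. c \<alpha> *\<^sub>C op_pow T \<alpha> x) = 0)"
proof -
  note p = functional_calculus_poly[OF functional_calculus_calculus assms, of c]
  have "calculus V T (da_poly G c) x = 0" if "x \<notin> V" for x
    using functional_calculus_calculus p that bounded_opsD(2) unfolding functional_calculus_def by blast
  then have "calculus V T (da_poly G c) = 0 \<longleftrightarrow> (\<forall>x\<in>V. calculus V T (da_poly G c) x = 0)"
    by (auto simp: fun_eq_iff zero_fun_apply)
  then show ?thesis using p by (simp add: Ann_c_def)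
qed

end

section \<open>The invariant complement\<close>

text \<open>The form in which the condition passes to invariant subspaces: only norms of adjoints
  have to be compared.\<close>

lemma row_contraction_iff:
  assumes V: "csubspace V" "closed V"
  shows "row_contraction V T \<longleftrightarrow> (\<forall>k. T k \<in> bounded_ops V) \<and>
    (\<forall>x\<in>V. (\<Sum>k\<in>UNIV. (norm (op_adjoint V (T k) x))\<^sup>2) \<le> (norm x)\<^sup>2)"
proof -
  have "cinner (x - (\<Sum>k\<in>UNIV. T k (op_adjoint V (T k) x))) x =
      of_real ((norm x)\<^sup>2 - (\<Sum>k\<in>UNIV. (norm (op_adjoint V (T k) x))\<^sup>2))"
    if "\<forall>k. T k \<in> bounded_ops V" "x \<in> V" for x
    using that by (simp add: cinner_diff_left cinner_sum_left cinner_op_adjoint[OF V] op_adjoint_in[OF V]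
        cinner_self)
  then show ?thesis unfolding row_contraction_def
    by (auto simp: nonneg_Reals_of_real_iff simp del: of_real_diff)
qed

text \<open>One functional is eliminated at a time by passing to its kernel in \<open>M\<close>.\<close>

lemma linear_system_solvable:
  fixes M :: "'a::complex_hilbert set"
  assumes "finite I" "csubspace M"
    and "\<And>i x y. i \<in> I \<Longrightarrow> x \<in> M \<Longrightarrow> y \<in> M \<Longrightarrow> l i (x + y) = l i x + l i y"
    and "\<And>i a x. i \<in> I \<Longrightarrow> x \<in> M \<Longrightarrow> l i (a *\<^sub>C x) = a * l i x"
    and "\<And>c. (\<And>x. x \<in> M \<Longrightarrow> (\<Sum>i\<in>I. c i * l i x) = (0::complex)) \<Longrightarrow> (\<Sum>i\<in>I. c i * b i) = 0"
  shows "\<exists>x\<in>M. \<forall>i\<in>I. l i x = b i"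
  using assms
proof (induction I arbitrary: M b rule: finite_induct)
  case empty
  then show ?case using csubspace_0 by blast
next
  case (insert j I)
  note M = insert.prems(1) and add = insert.prems(2) and scale = insert.prems(3) and cons = insert.prems(4)
  show ?case
  proof (cases "\<forall>x\<in>M. l j x = 0")
    case True
    \<comment> \<open>If the functional \<open>l j\<close> vanishes on \<open>M\<close>, that is
      itself a linear relation, and consistency forces \<open>b j = 0\<close>.\<close>
    have "(\<Sum>i\<in>insert j I. (if i = j then 1 else 0) * b i) = 0"
      by (rule cons) (use True insert.hyps in \<open>auto intro!: sum.neutral\<close>)
    moreover have "(\<Sum>i\<in>I. (if i = j then 1 else 0) * b i) = 0"
      by (rule sum.neutral) (use insert.hyps in auto)
    ultimately have bj: "b j = 0" using insert.hyps by simp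
    have "\<exists>x\<in>M. \<forall>i\<in>I. l i x = b i"
    proof (rule insert.IH[OF M])
      fix c assume c: "\<And>x. x \<in> M \<Longrightarrow> (\<Sum>i\<in>I. c i * l i x) = 0"
      have "(\<Sum>i\<in>insert j I. c i * b i) = 0"
        by (rule cons) (use c True insert.hyps in auto)
      then show "(\<Sum>i\<in>I. c i * b i) = 0" using insert.hyps bj by simp
    qed (use add scale in auto)
    then show ?thesis using True bj by auto
  next
    case False
    then obtain u0 where u0: "u0 \<in> M" "l j u0 \<noteq> 0" by blast
    define u where "u = (1 / l j u0) *\<^sub>C u0"
    have u: "u \<in> M" "l j u = 1"
      using u0 csubspace_scaleC[OF M] scale[of j u0] by (auto simp: u_def)
    define M' where "M' = {x\<in>M. l j x = 0}"
    have l0: "l j 0 = 0" using scale[of j 0 0] csubspace_0[OF M] by simp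
    have M': "csubspace M'"
      using M l0 add scale unfolding csubspace_def M'_def by auto
    have proj: "x + (- l j x) *\<^sub>C u \<in> M'" if "x \<in> M" for x
      using that u csubspace_add[OF M] csubspace_scaleC[OF M] by (simp add: M'_def add scale)
    \<comment> \<open>The solution will be x + \<open>b j\<close> times u: x in the kernel leaves
      equation \<open>j\<close> to u, and the other right-hand sides are corrected for u.\<close>
    have "\<exists>x\<in>M'. \<forall>i\<in>I. l i x = b i - b j * l i u"
    proof (rule insert.IH[OF M'])
      fix c assume c: "\<And>x. x \<in> M' \<Longrightarrow> (\<Sum>i\<in>I. c i * l i x) = 0"
      \<comment> \<open>A relation on the kernel extends to \<open>M\<close> by composing with the
        projection along \<open>u\<close>; this produces the coefficient at
        \<open>j\<close>.\<close>
      define d where "d i = (if i = j then - (\<Sum>i\<in>I. c i * l i u) else c i)" for i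
      have d: "(\<Sum>i\<in>insert j I. d i * r i) = - (\<Sum>i\<in>I. c i * l i u) * r j + (\<Sum>i\<in>I. c i * r i)" for r
      proof -
        have "(\<Sum>i\<in>I. d i * r i) = (\<Sum>i\<in>I. c i * r i)"
          by (rule sum.cong) (use insert.hyps in \<open>auto simp: d_def\<close>)
        then show ?thesis using insert.hyps by (simp add: d_def)
      qed
      have "(\<Sum>i\<in>insert j I. d i * b i) = 0"
      proof (rule cons)
        fix x assume x: "x \<in> M"
        have "0 = (\<Sum>i\<in>I. c i * l i (x + (- l j x) *\<^sub>C u))" using c[OF proj[OF x]] by simp
        also have "\<dots> = (\<Sum>i\<in>I. c i * (l i x - l j x * l i u))"
          using x u csubspace_scaleC[OF M] by (intro sum.cong refl) (simp add: add scale)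
        also have "\<dots> = (\<Sum>i\<in>insert j I. d i * l i x)"
          unfolding d by (simp add: algebra_simps sum_subtractf sum_distrib_left)
        finally show "(\<Sum>i\<in>insert j I. d i * l i x) = 0" by simp
      qed
      then show "(\<Sum>i\<in>I. c i * (b i - b j * l i u)) = 0"
        unfolding d by (simp add: algebra_simps sum_subtractf sum_distrib_left)
    qed (use add scale in \<open>auto simp: M'_def\<close>)
    then obtain x where x: "x \<in> M'" "\<forall>i\<in>I. l i x = b i - b j * l i u" by blast
    then have xM: "x \<in> M" "l j x = 0" by (auto simp: M'_def)
    have "x + b j *\<^sub>C u \<in> M" using xM u csubspace_add[OF M] csubspace_scaleC[OF M] by simp
    moreover have "l i (x + b j *\<^sub>C u) = b i" if "i \<in> insert j I" for i
      using that x(2) xM u csubspace_scaleC[OF M] by (auto simp: add scale)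
    ultimately show ?thesis by blast
  qed
qed

text \<open>The adjoint of a restriction is the adjoint followed by projection to \<open>M\<close>,
  so its norms do not grow. The norm bound is obtained without the projection, by Cauchy--Schwarz
  applied to ||y||^2 = <y, T_k^* x>.\<close>

lemma nilpotent_row_restrict:
  fixes T :: "'d::finite \<Rightarrow> 'a::complex_hilbert \<Rightarrow> 'a"
  assumes "nilpotent_row UNIV T" and cl: "closed M" and inv: "invariant_for T M"
  shows "nilpotent_row M (\<lambda>k. op_restrict M (T k))"
proof -
  interpret U: nilpotent_row UNIV T by fact
  let ?R = "\<lambda>k. op_restrict M (T k)"
  have M: "csubspace M" using inv by (simp add: invariant_for_def)
  have TM: "T k x \<in> M" if "x \<in> M" for k x using inv that by (auto simp: invariant_for_def)
  have R: "?R k x = T k x" if "x \<in> M" for k x using that by (simp add: op_restrict_def)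
  have Rb: "?R k \<in> bounded_ops M" for k
    using bounded_opsD(3-5)[OF U.T_bounded[of k]] TM M
    by (auto simp: bounded_ops_def op_restrict_def csubspace_add csubspace_scaleC)
  have le: "norm (op_adjoint M (?R k) x) \<le> norm (U.A k x)" if x: "x \<in> M" for k x
  proof -
    let ?y = "op_adjoint M (?R k) x"
    have y: "?y \<in> M" by (rule op_adjoint_in[OF M cl Rb x])
    have "cinner ?y ?y = cinner (T k ?y) x"
      using cinner_op_adjoint[OF M cl Rb x y] R[OF y] by simp
    also have "\<dots> = cinner ?y (U.A k x)" by (simp add: U.cinner_A)
    finally have "(norm ?y)\<^sup>2 = cmod (cinner ?y (U.A k x))"
      by (metis abs_of_nonneg cinner_self norm_of_real zero_le_power2)
    then have "norm ?y * norm ?y \<le> norm ?y * norm (U.A k x)"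
      using cauchy_schwarz[of ?y "U.A k x"] by (simp add: power2_eq_square)
    then show ?thesis by (cases "?y = 0") (auto simp: mult_le_cancel_left)
  qed
  have "(\<Sum>k\<in>UNIV. (norm (op_adjoint M (?R k) x))\<^sup>2) \<le> (norm x)\<^sup>2" if "x \<in> M" for x
  proof -
    have "(\<Sum>k\<in>UNIV. (norm (op_adjoint M (?R k) x))\<^sup>2) \<le> (\<Sum>k\<in>UNIV. (norm (U.A k x))\<^sup>2)"
      by (intro sum_mono power_mono le that) auto
    also have "\<dots> \<le> (norm x)\<^sup>2"
      using U.row row_contraction_iff[OF csubspace_UNIV closed_UNIV, of T] by (simp add: U.A_def)
    finally show ?thesis .
  qed
  then have "row_contraction M ?R" unfolding row_contraction_iff[OF M cl] using Rb by blast
  moreover have "commuting M ?R" unfolding commuting_def using R TM U.T_commute by auto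
  moreover have "nilpotent M ?R" unfolding nilpotent_def
  proof
    fix k
    obtain m where m: "\<forall>x. (T k ^^ m) x = 0" using U.nil unfolding nilpotent_def by blast
    have "(?R k ^^ n) x = (T k ^^ n) x \<and> (T k ^^ n) x \<in> M" if "x \<in> M" for x n
      by (induction n) (use that R TM in auto)
    then show "\<exists>m. \<forall>x\<in>M. (?R k ^^ m) x = 0" using m by (intro exI[of _ m]) auto
  qed
  ultimately show ?thesis using M cl by unfold_locales
qed

text \<open>A nonzero z would be approximated by some y orthogonal to z with ||z - y|| < ||z||,
  although ||z||^2 = <z, z - y>.\<close>

lemma cyclic_orthogonal_zero:
  fixes M :: "'a::complex_hilbert set"
  assumes cyc: "cyclic_vector M S \<xi>" and z: "z \<in> M" and orth: "\<And>w. cinner z (foldr S w \<xi>) = 0"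
  shows "z = 0"
proof (rule ccontr)
  assume "z \<noteq> 0"
  have "csubspace {y. cinner z y = 0}"
    by (simp add: csubspace_def cinner_add_right cinner_scaleC_right)
  then have hull: "csubspace hull {foldr S w \<xi> | w. True} \<subseteq> {y. cinner z y = 0}"
    by (intro hull_minimal) (use orth in auto)
  have "z \<in> closure (csubspace hull {foldr S w \<xi> | w. True})"
    using cyc z by (simp add: cyclic_vector_def)
  then obtain y where "y \<in> csubspace hull {foldr S w \<xi> | w. True}" "dist y z < norm z"
    unfolding closure_approachable using \<open>z \<noteq> 0\<close> zero_less_norm_iff by blast
  then have y: "cinner z y = 0" "norm (z - y) < norm z"
    using hull by (auto simp: dist_norm norm_minus_commute)
  have "(norm z)\<^sup>2 = cmod (cinner z (z - y))"
    using y(1) by (simp add: cinner_diff_right cinner_self norm_power)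
  also have "\<dots> \<le> norm z * norm (z - y)" by (rule cauchy_schwarz)
  also have "\<dots> < norm z * norm z" using y(2) \<open>z \<noteq> 0\<close> by (intro mult_strict_left_mono) auto
  finally show False by (simp add: power2_eq_square)
qed

theorem theorem5p1:
  fixes T :: "'d::finite \<Rightarrow> 'a::complex_hilbert \<Rightarrow> 'a"
    and M :: "'a set"
  assumes "row_contraction UNIV T"
    and "commuting UNIV T"
    and "nilpotent UNIV T"
    and "closed M"
    and "invariant_for T M"
    and "\<exists>\<xi>. cyclic_vector M (\<lambda>k. op_adjoint M (op_restrict M (T k))) \<xi>"
    and "Ann_c M (\<lambda>k. op_restrict M (T k)) = Ann_c UNIV T"
  shows "\<exists>N. invariant_for T N \<and> M \<inter> N = {0} \<and> closure {x + y | x y. x \<in> M \<and> y \<in> N} = UNIV"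
proof -
  interpret U: nilpotent_row UNIV T
    using assms(1-3) csubspace_UNIV by unfold_locales auto
  interpret R: nilpotent_row M "\<lambda>k. op_restrict M (T k)"
    using nilpotent_row_restrict[OF U.nilpotent_row_axioms assms(4,5)] .
  obtain \<xi> where cyc: "cyclic_vector M R.A \<xi>"
    using assms(6) unfolding R.A_def[abs_def] by blast
  then have \<xi>: "\<xi> \<in> M" by (simp add: cyclic_vector_def)
  have TM: "T k x \<in> M" if "x \<in> M" for k x using assms(5) that by (auto simp: invariant_for_def)
  have Tr: "op_restrict M (T k) x = T k x" if "x \<in> M" for k x using that by (simp add: op_restrict_def)
  have RT: "op_pow (\<lambda>k. op_restrict M (T k)) \<alpha> x = op_pow T \<alpha> x" and TpM: "op_pow T \<alpha> x \<in> M"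
    if "x \<in> M" for \<alpha> x
  proof -
    have "op_pow (\<lambda>k. op_restrict M (T k)) \<alpha> x = op_pow T \<alpha> x \<and> op_pow T \<alpha> x \<in> M"
      by (induction \<alpha> rule: midx_induct)
        (use that TM Tr in \<open>simp_all add: U.T_pow_add_unit R.T_pow_add_unit\<close>)
    then show "op_pow (\<lambda>k. op_restrict M (T k)) \<alpha> x = op_pow T \<alpha> x" "op_pow T \<alpha> x \<in> M" by auto
  qed
  define N where "N = {x. \<forall>\<alpha>. cinner (op_pow T \<alpha> x) \<xi> = 0}"
  have N: "csubspace N"
    by (simp add: csubspace_def N_def U.T_pow_zero U.T_pow_plus U.T_pow_scaleC cinner_add_left cinner_scaleC_left)
  have TN: "T k x \<in> N" if "x \<in> N" for k x
    using that by (simp add: N_def U.T_pow_commute U.T_pow_add_unit[symmetric])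
  have MN: "z = 0" if "z \<in> M" "z \<in> N" for z
  proof (rule cyclic_orthogonal_zero[OF cyc that(1)])
    fix w
    have wM: "foldr R.A w \<xi> \<in> M" for w by (cases w) (auto simp: \<xi> R.A_in)
    show "cinner z (foldr R.A w \<xi>) = 0"
      using that
    \<comment> \<open>Each letter moves across the inner product as T_k applied to z, which stays in
      both M and N; hence z must vary.\<close>
    proof (induction w arbitrary: z)
      case Nil
      then have "cinner (op_pow T 0 z) \<xi> = 0" unfolding N_def by blast
      then show ?case by simp
    next
      case (Cons k w)
      have "cinner z (R.A k (foldr R.A w \<xi>)) = cinner (op_restrict M (T k) z) (foldr R.A w \<xi>)"
        by (rule R.cinner_A[symmetric]) (use Cons.prems wM in auto)
      also have "\<dots> = 0" using Cons TM TN by (simp add: op_restrict_def)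
      finally show ?case by simp
    qed
  qed
  have vanish: "(\<Sum>\<alpha>\<in>U.F. c \<alpha> *\<^sub>C op_pow T \<alpha> x) = 0"
    if c: "\<And>m. m \<in> M \<Longrightarrow> (\<Sum>\<alpha>\<in>U.F. c \<alpha> * cinner (op_pow T \<alpha> m) \<xi>) = 0" for c x
  proof -
    have "(\<Sum>\<alpha>\<in>U.F. c \<alpha> *\<^sub>C op_pow T \<alpha> m) = 0" if m: "m \<in> M" for m
    proof (rule MN)
      show "(\<Sum>\<alpha>\<in>U.F. c \<alpha> *\<^sub>C op_pow T \<alpha> m) \<in> M"
        by (intro csubspace_sum csubspace_scaleC R.V TpM m)
      \<comment> \<open>Powers commute, so applying one to the combination evaluates the assumed
        relation at another vector of M.\<close>
      have "cinner (op_pow T \<beta> (\<Sum>\<alpha>\<in>U.F. c \<alpha> *\<^sub>C op_pow T \<alpha> m)) \<xi> =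
          (\<Sum>\<alpha>\<in>U.F. c \<alpha> * cinner (op_pow T \<alpha> (op_pow T \<beta> m)) \<xi>)" for \<beta>
        by (simp add: U.T_pow_sum U.T_pow_scaleC cinner_sum_left cinner_scaleC_left U.T_pow_add[symmetric]
            add.commute)
      then show "(\<Sum>\<alpha>\<in>U.F. c \<alpha> *\<^sub>C op_pow T \<alpha> m) \<in> N"
        using c[OF TpM[OF m]] by (simp add: N_def)
    qed
    \<comment> \<open>Here the equality of annihilators carries the relation from M to the whole
      space.\<close>
    then have "da_poly U.F c \<in> Ann_c M (\<lambda>k. op_restrict M (T k))"
      by (simp add: R.da_poly_Ann_c_iff RT)
    then show ?thesis using U.da_poly_Ann_c_iff[of U.F c] assms(7) by simp
  qed
  have "\<exists>m\<in>M. x - m \<in> N" for x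
  proof -
    have "\<exists>m\<in>M. \<forall>\<alpha>\<in>U.F. cinner (op_pow T \<alpha> m) \<xi> = cinner (op_pow T \<alpha> x) \<xi>"
    proof (rule linear_system_solvable[OF U.finite_F R.V(1)])
      \<comment> \<open>The solvability criterion: every relation among the functionals on M must
        also hold for their values at x.\<close>
      fix c assume "\<And>m. m \<in> M \<Longrightarrow> (\<Sum>\<alpha>\<in>U.F. c \<alpha> * cinner (op_pow T \<alpha> m) \<xi>) = 0"
      then have "cinner (\<Sum>\<alpha>\<in>U.F. c \<alpha> *\<^sub>C op_pow T \<alpha> x) \<xi> = 0" by (simp add: vanish)
      then show "(\<Sum>\<alpha>\<in>U.F. c \<alpha> * cinner (op_pow T \<alpha> x) \<xi>) = 0"
        by (simp add: cinner_sum_left cinner_scaleC_left)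
    qed (simp_all add: U.T_pow_plus U.T_pow_scaleC cinner_add_left cinner_scaleC_left)
    then obtain m where m: "m \<in> M" "\<forall>\<alpha>\<in>U.F. cinner (op_pow T \<alpha> m) \<xi> = cinner (op_pow T \<alpha> x) \<xi>" by blast
    have "cinner (op_pow T \<alpha> (x - m)) \<xi> = 0" for \<alpha>
    proof (cases "\<alpha> \<in> U.F")
      case True
      then have "cinner (op_pow T \<alpha> (x + (- 1) *\<^sub>C m)) \<xi> = 0"
        using m(2) by (simp only: U.T_pow_plus U.T_pow_scaleC UNIV_I cinner_add_left cinner_scaleC_left) simp
      then show ?thesis by (simp add: scaleC_minus_one)
    qed (simp add: U.T_pow_outside)
    with m(1) show ?thesis by (auto simp: N_def)
  qed
  then have "{x + y | x y. x \<in> M \<and> y \<in> N} = UNIV" by (auto, metis add_diff_cancel_left' diff_add_cancel add.commute)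
  moreover have "M \<inter> N = {0}" using MN csubspace_0[OF R.V(1)] csubspace_0[OF N] by blast
  moreover have "invariant_for T N" using N TN by (auto simp: invariant_for_def)
  ultimately show ?thesis by (intro exI[of _ N]) simp
qed

end
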